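(* Let $\nu$ be an inhomogeneous self-similar measure on $\mathbb{R}^d$ with condensation measure $\mu$, satisfying the inhomogeneous open set condition (iOSC), such that the $L^{q}$-spectrum $\beta_{\mu}$ of $\mu$ exists as a limit on $(0,1)$. Then the quantization dimension $D_r(\nu)$ exists for every $r>0$ with \[ D_{r}(\nu)=\frac{rq_{r}}{1-q_{r}}, \] where $q_{r}$ is defined in terms of the $L^{q}$-spectrum of $\nu$, which is given, for $q\in(0,1)$, by \[ \beta_{\nu}(q)=\max\left\{\beta_{\mu}(q),\varrho_{\nu}(q)\right\}. \]
   Context: Inhomogeneous self-similar measure: let $(f_i)_{i=1}^N$ be contractive similitudes on $\mathbb{R}^d$ with contraction ratios $r_i\in(0,1)$, $(p_i)_{i=0,\dots,N}\in(0,1)^{N+1}$ a probability vector, and $\mu$ a compactly supported Borel probability measure on $\mathbb{R}^d$ (the condensation measure). The inhomogeneous self-similar measure $\nu$ is the unique (compactly supported Borel probability) solution of $\nu=p_0\mu+\sum_{i=1}^Np_i\,\nu\circ f_i^{-1}$. The iOSC holds if there is a bounded non-empty open set $U$ such that $f_i(U)\subset U$ for all $i$, $\mathrm{supp}(\mu)\subset\overline{U}$, $f_i(U)\cap\mathrm{supp}(\mu)=\emptyset$ for all $i$, and $f_i(U)\cap f_j(U)=\emptyset$ for all $i\ne j$. The function $\varrho_\nu:(0,1)\to\mathbb{R}$ is defined as the solution of $\sum_{k=1}^Np_k^q\,r_k^{\varrho_\nu(q)}=1$. $L^q$-spectrum: let $\mathcal{D}_n$ be the partition of $\mathbb{R}^d$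 into half-open cubes $\prod_{i=1}^d(k_i2^{-n},(k_i+1)2^{-n}]$, $k\in\mathbb{Z}^d$. For a compactly supported Borel probability measure $\eta$ and $q\ge0$, $\beta_\eta(q)=\limsup_{n\to\infty}\frac{\log\left(\sum_{C\in\mathcal{D}_n}\eta(C)^q\right)}{\log(2^n)}$ (with $0^0=0$); "exists as a limit on $(0,1)$" means that the limsup is a limit for every $q\in(0,1)$. For $r>0$, $q_r=\inf\{q>0:\beta_\nu(q)<rq\}$. Quantization dimension: for $r>0$ let $\mathfrak{e}_{n,r}(\nu)=\inf\left\{\left(\int d(x,\alpha)^r\,d\nu(x)\right)^{1/r}:\alpha\subset\mathbb{R}^d,\ 1\le\mathrm{card}(\alpha)\le n\right\}$ with $d(x,\alpha)=\min_{y\in\alpha}\|x-y\|$; $D_r(\nu)=\lim_{n\to\infty}\frac{\log n}{-\log\mathfrak{e}_{n,r}(\nu)}$ whenever this limit exists. *)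

theory Defs
  imports "HOL-Probability.Probability"
begin

definition msupport :: "'a::topological_space measure \<Rightarrow> 'a set" where
  "msupport \<eta> = {x. \<forall>V. open V \<and> x \<in> V \<longrightarrow> emeasure \<eta> V > 0}"

definition compactly_supported_borel_prob :: "'a::topological_space measure \<Rightarrow> bool" where
  "compactly_supported_borel_prob \<eta> \<longleftrightarrow>
     prob_space \<eta> \<and> sets \<eta> = sets borel \<and> compact (msupport \<eta>)"

definition contractive_similitude :: "real \<Rightarrow> ('a::metric_space \<Rightarrow> 'a) \<Rightarrow> bool" where
  "contractive_similitude c f \<longleftrightarrow> 0 < c \<and> c < 1 \<and> (\<forall>x y. dist (f x) (f y) = c * dist x y)"

text \<open>The similitudes are \<open>f 1, \<dots>, f N\<close>, and \<open>p 0\<close> is the weight of the condensation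
  measure \<open>\<mu>\<close>. Compactly supported Borel probability solutions are unique, so the predicate
  below determines \<open>\<nu>\<close>.\<close>

definition inhom_self_similar_measure ::
  "nat \<Rightarrow> (nat \<Rightarrow> 'a::euclidean_space \<Rightarrow> 'a) \<Rightarrow> (nat \<Rightarrow> real) \<Rightarrow> 'a measure \<Rightarrow> 'a measure \<Rightarrow> bool" where
  "inhom_self_similar_measure N f p \<mu> \<nu> \<longleftrightarrow>
     compactly_supported_borel_prob \<nu> \<and>
     (\<forall>A\<in>sets borel. measure \<nu> A =
        p 0 * measure \<mu> A + (\<Sum>i=1..N. p i * measure (distr \<nu> borel (f i)) A))"

definition iOSC :: "nat \<Rightarrow> (nat \<Rightarrow> 'a::euclidean_space \<Rightarrow> 'a) \<Rightarrow> 'a measure \<Rightarrow> bool" where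
  "iOSC N f \<mu> \<longleftrightarrow>
     (\<exists>U. bounded U \<and> open U \<and> U \<noteq> {} \<and>
          (\<forall>i\<in>{1..N}. f i ` U \<subseteq> U) \<and>
          msupport \<mu> \<subseteq> closure U \<and>
          (\<forall>i\<in>{1..N}. f i ` U \<inter> msupport \<mu> = {}) \<and>
          (\<forall>i\<in>{1..N}. \<forall>j\<in>{1..N}. i \<noteq> j \<longrightarrow> f i ` U \<inter> f j ` U = {}))"

text \<open>The equation has exactly one solution when \<open>N \<ge> 1\<close>, all \<open>p k > 0\<close> and all
  \<open>c k\<close> lie in \<open>(0,1)\<close>: its left-hand side is then continuous and strictly decreasing in \<open>s\<close>,
  with limits \<open>\<infinity>\<close> and \<open>0\<close>.\<close>

definition rho :: "nat \<Rightarrow> (nat \<Rightarrow> real) \<Rightarrow> (nat \<Rightarrow> real) \<Rightarrow> real \<Rightarrow> real" where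
  "rho N p c q = (THE s. (\<Sum>k=1..N. p k powr q * c k powr s) = 1)"

definition dyadic_cubes :: "nat \<Rightarrow> 'a::euclidean_space set set" where
  "dyadic_cubes n =
     range (\<lambda>k :: 'a \<Rightarrow> int.
       {x. \<forall>b\<in>Basis. of_int (k b) / 2 ^ n < x \<bullet> b \<and> x \<bullet> b \<le> of_int (k b + 1) / 2 ^ n})"

text \<open>\<open>0 powr q = 0\<close> for every \<open>q\<close>, which includes the convention \<open>0\<^sup>0 = 0\<close>. For a
  compactly supported measure only finitely many summands are nonzero.\<close>

definition lq_approx :: "'a::euclidean_space measure \<Rightarrow> real \<Rightarrow> nat \<Rightarrow> real" where
  "lq_approx \<eta> q n = ln (\<Sum>\<^sub>\<infinity>C\<in>dyadic_cubes n. measure \<eta> C powr q) / ln (2 ^ n)"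

definition lq_spectrum :: "'a::euclidean_space measure \<Rightarrow> real \<Rightarrow> ereal" where
  "lq_spectrum \<eta> q = limsup (\<lambda>n. ereal (lq_approx \<eta> q n))"

definition lq_spectrum_exists_as_limit :: "'a::euclidean_space measure \<Rightarrow> bool" where
  "lq_spectrum_exists_as_limit \<eta> \<longleftrightarrow>
     (\<forall>q\<in>{0<..<1}. (\<lambda>n. ereal (lq_approx \<eta> q n)) \<longlonglongrightarrow> lq_spectrum \<eta> q)"

definition q_crit :: "'a::euclidean_space measure \<Rightarrow> real \<Rightarrow> real" where
  "q_crit \<nu> r = Inf {q. 0 < q \<and> lq_spectrum \<nu> q < ereal (r * q)}"

text \<open>Since infinite sets have \<open>card = 0\<close>, the condition \<open>1 \<le> card \<alpha>\<close> forces \<open>\<alpha>\<close> to be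
  finite and nonempty, and \<open>infdist x \<alpha>\<close> is then a minimum.\<close>

definition quantization_error :: "'a::euclidean_space measure \<Rightarrow> real \<Rightarrow> nat \<Rightarrow> real" where
  "quantization_error \<nu> r n =
     Inf {(LINT x|\<nu>. infdist x \<alpha> powr r) powr (1 / r) | \<alpha>. 1 \<le> card \<alpha> \<and> card \<alpha> \<le> n}"

text \<open>If \<open>\<nu>\<close> is finitely supported, the error vanishes for large \<open>n\<close>; as \<open>ln 0 = 0\<close> and
  \<open>x / 0 = 0\<close>, the quotient is then \<open>0\<close>, in accordance with the convention
  \<open>log n / (- log 0) = log n / \<infinity> = 0\<close>.\<close>

definition has_quantization_dimension :: "'a::euclidean_space measure \<Rightarrow> real \<Rightarrow> real \<Rightarrow> bool" where
  "has_quantization_dimension \<nu> r D \<longleftrightarrow>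
     (\<lambda>n. ln (real n) / (- ln (quantization_error \<nu> r n))) \<longlonglongrightarrow> D"

end

theory Submission
  imports Defs
begin

text \<open>
  Spectrum. Up to constants, the sum of \<open>\<nu>(C)\<^sup>q\<close> over dyadic cubes of side \<open>\<delta>\<close> is the largest sum of
  \<open>\<nu>(B)\<^sup>q\<close> over balls of radius comparable to \<open>\<delta>\<close> around a \<open>\<delta>\<close>-separated set, and the latter
  behaves well under similitudes. The self-similarity turns it into a renewal inequality relating
  the scale \<open>\<delta>\<close> to the scales \<open>\<delta> / c i\<close>, which gives growth at most \<open>\<delta>\<^sup>-\<^sup>s\<close> for every
  \<open>s > max (\<beta>\<^sub>\<mu> q) (\<rho>\<^sub>\<nu> q)\<close>. Conversely \<open>\<nu> \<ge> p 0 * \<mu>\<close>, and the images of one ball under the words of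
  the iterated function system, stopped at scale \<open>\<delta>\<close>, are disjoint by the open set condition; this
  gives \<open>\<rho>\<^sub>\<nu> q\<close> as a lower bound.

  Quantization, for any compactly supported measure whose spectrum \<open>b\<close> is a limit. If
  \<open>b q < r * q\<close>, there are \<open>O(t\<^sup>-\<^sup>q)\<close> dyadic cubes \<open>C\<close>, of any side \<open>2\<^sup>-\<^sup>n\<close>, with
  \<open>\<nu>(C) * 2\<^sup>-\<^sup>n\<^sup>r \<ge> t\<close>, and their corners quantize \<open>\<nu>\<close> with an \<open>r\<close>-th power error \<open>O(t\<^sup>1\<^sup>-\<^sup>q)\<close>. If
  \<open>b \<ge> r * q\<close> up to some point beyond \<open>q\<close>, a pigeonhole argument on the second differences of the bounded
  monotone function \<open>b\<close> finds an exponent \<open>a\<close> such that at every large level \<open>m\<close> at least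
  \<open>2\<^sup>m\<^sup>q\<^sup>(\<^sup>r\<^sup>+\<^sup>a\<^sup>)\<close> cubes have mass at least \<open>2\<^sup>-\<^sup>m\<^sup>a\<close>; fewer points than that leave most of them uncovered.
\<close>

subsection \<open>Dyadic cubes\<close>

text \<open>The upper corner of the half-open dyadic cube containing \<open>x\<close>; it belongs to that cube and
  serves as its name.\<close>

definition grid_point :: "nat \<Rightarrow> 'a::euclidean_space \<Rightarrow> 'a" where
  "grid_point n x = (\<Sum>b\<in>Basis. (of_int \<lceil>2 ^ n * (x \<bullet> b)\<rceil> / 2 ^ n) *\<^sub>R b)"

definition cell :: "nat \<Rightarrow> 'a::euclidean_space \<Rightarrow> 'a set" where
  "cell n x = {y. grid_point n y = grid_point n x}"

lemma grid_point_inner: "b \<in> Basis \<Longrightarrow> grid_point n x \<bullet> b = of_int \<lceil>2 ^ n * (x \<bullet> b)\<rceil> / 2 ^ n"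
  by (simp add: grid_point_def inner_sum_left inner_Basis if_distrib cong: if_cong)

lemma grid_point_eq_iff:
  "grid_point n y = grid_point n x \<longleftrightarrow> (\<forall>b\<in>Basis. \<lceil>2 ^ n * (y \<bullet> b)\<rceil> = \<lceil>2 ^ n * (x \<bullet> b)\<rceil>)"
  by (auto simp: euclidean_eq_iff[where 'a='a] grid_point_inner)

lemma grid_point_idem [simp]: "grid_point n (grid_point n x) = grid_point n x"
  by (simp add: grid_point_eq_iff grid_point_inner)

lemma cell_grid_point [simp]: "cell n (grid_point n x) = cell n x"
  by (simp add: cell_def)

lemma mem_cell_self [simp]: "x \<in> cell n x"
  by (simp add: cell_def)

lemma grid_point_range: "z \<in> range (grid_point n) \<Longrightarrow> grid_point n z = z"
  by auto

lemma cell_range_eq: "z \<in> range (grid_point n) \<Longrightarrow> cell n z = {y. grid_point n y = z}"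
  by (auto simp: cell_def)

text \<open>A point lies in the cube with index \<open>k\<close> iff its scaled coordinates have
  ceiling \<open>k b + 1\<close>: ceilings match intervals open on the left and closed on the right.
  So the cubes are the fibres of \<open>grid_point n\<close>.\<close>

lemma dyadic_cubes_eq: "dyadic_cubes n = cell n ` range (grid_point n :: 'a::euclidean_space \<Rightarrow> 'a)"
proof -
  have cube: "{x. \<forall>b\<in>Basis. of_int (k b) / 2 ^ n < x \<bullet> b \<and> x \<bullet> b \<le> of_int (k b + 1) / 2 ^ n} =
      {x. \<forall>b\<in>Basis. \<lceil>2 ^ n * (x \<bullet> b)\<rceil> = k b + 1}" for k :: "'a \<Rightarrow> int"
    by (auto simp: ceiling_eq_iff field_simps)
  have "{x. \<forall>b\<in>Basis. \<lceil>2 ^ n * (x \<bullet> b)\<rceil> = k b + 1} =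
      cell n (\<Sum>b\<in>Basis. (of_int (k b + 1) / 2 ^ n) *\<^sub>R b)" for k :: "'a \<Rightarrow> int"
    by (simp add: cell_def grid_point_eq_iff inner_sum_left inner_Basis if_distrib cong: if_cong)
  then have "dyadic_cubes n \<subseteq> range (cell n :: 'a \<Rightarrow> 'a set)"
    unfolding dyadic_cubes_def cube by auto
  \<comment> \<open>\<open>k\<close> indexes the lower corner and \<open>grid_point\<close> gives
    the upper one, hence the shift by 1.\<close>
  moreover have "cell n x \<in> dyadic_cubes n" for x :: 'a
    unfolding dyadic_cubes_def cube
    by (rule image_eqI[where x = "\<lambda>b. \<lceil>2 ^ n * (x \<bullet> b)\<rceil> - 1"])
       (auto simp: cell_def grid_point_eq_iff)
  moreover have "range (cell n :: 'a \<Rightarrow> 'a set) = cell n ` range (grid_point n)"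
    by (simp add: image_image)
  ultimately show ?thesis
    by blast
qed

lemma inj_on_cell: "inj_on (cell n) (range (grid_point n :: 'a::euclidean_space \<Rightarrow> 'a))"
proof (rule inj_onI)
  fix x y :: 'a
  assume xy: "x \<in> range (grid_point n)" "y \<in> range (grid_point n)" "cell n x = cell n y"
  then have "x \<in> cell n y"
    using mem_cell_self[of x n] by simp
  then show "x = y"
    using grid_point_range[OF xy(1)] grid_point_range[OF xy(2)] by (simp add: cell_def)
qed

text \<open>Rounding up moves each coordinate by at most the side length, and the sum of the
  coordinate distances bounds the norm. The factor \<open>DIM('a)\<close> is crude, but only
  constants are at stake.\<close>

lemma dist_grid_point: "dist x (grid_point n x) \<le> DIM('a) / 2 ^ n" for x :: "'a::euclidean_space"
proof -
  have "\<bar>(x - grid_point n x) \<bullet> b\<bar> \<le> 1 / 2 ^ n" if "b \<in> Basis" for b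
  proof -
    have "\<bar>2 ^ n * (x \<bullet> b) - of_int \<lceil>2 ^ n * (x \<bullet> b)\<rceil>\<bar> \<le> 1"
      by linarith
    then have "\<bar>2 ^ n * (x \<bullet> b) - of_int \<lceil>2 ^ n * (x \<bullet> b)\<rceil>\<bar> / 2 ^ n \<le> 1 / 2 ^ n"
      by (rule divide_right_mono) simp
    moreover have "(x - grid_point n x) \<bullet> b = (2 ^ n * (x \<bullet> b) - of_int \<lceil>2 ^ n * (x \<bullet> b)\<rceil>) / 2 ^ n"
      using that by (simp add: inner_diff_left grid_point_inner field_simps)
    ultimately show ?thesis
      by (simp add: abs_divide)
  qed
  then have "(\<Sum>b\<in>Basis. \<bar>(x - grid_point n x) \<bullet> b\<bar>) \<le> (\<Sum>b\<in>(Basis::'a set). 1 / 2 ^ n)"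
    by (rule sum_mono)
  then show ?thesis
    using norm_le_l1[of "x - grid_point n x"] by (simp add: dist_norm)
qed

lemma grid_separated:
  assumes "x \<in> range (grid_point n)" "y \<in> range (grid_point n)" "x \<noteq> (y :: 'a::euclidean_space)"
  shows "1 / 2 ^ n \<le> dist x y"
proof -
  obtain u v where uv: "x = grid_point n u" "y = grid_point n v"
    using assms by auto
  then obtain b :: 'a where b: "b \<in> Basis" "\<lceil>2 ^ n * (u \<bullet> b)\<rceil> \<noteq> \<lceil>2 ^ n * (v \<bullet> b)\<rceil>"
    using assms(3) grid_point_eq_iff by metis
  then have "1 \<le> \<bar>real_of_int (\<lceil>2 ^ n * (u \<bullet> b)\<rceil> - \<lceil>2 ^ n * (v \<bullet> b)\<rceil>)\<bar>"
    by linarith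
  then have "1 / 2 ^ n \<le> \<bar>real_of_int (\<lceil>2 ^ n * (u \<bullet> b)\<rceil> - \<lceil>2 ^ n * (v \<bullet> b)\<rceil>)\<bar> / 2 ^ n"
    by (rule divide_right_mono) simp
  also have "\<dots> = \<bar>(x - y) \<bullet> b\<bar>"
    using b by (simp add: uv inner_diff_left grid_point_inner diff_divide_distrib[symmetric] abs_divide)
  also have "\<dots> \<le> dist x y"
    using Basis_le_norm[OF b(1)] by (simp add: dist_norm)
  finally show ?thesis .
qed

lemma cell_borel [measurable]: "cell n x \<in> sets borel"
proof -
  have "cell n x = (\<Inter>b\<in>Basis. {y. \<lceil>2 ^ n * (y \<bullet> b)\<rceil> = \<lceil>2 ^ n * (x \<bullet> b)\<rceil>})"
    by (auto simp: cell_def grid_point_eq_iff)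
  then show ?thesis
    by (simp add: sets.finite_INT)
qed

text \<open>A grid point is determined by the integers \<open>2 ^ n * (z \<bullet> b)\<close>, and
  the norm bound confines these to \<open>{-L..L}\<close>.\<close>

lemma grid_count:
  assumes "0 \<le> \<rho>"
  shows "finite {z \<in> range (grid_point n). norm (z::'a::euclidean_space) \<le> \<rho>}"
    and "real (card {z \<in> range (grid_point n). norm (z::'a::euclidean_space) \<le> \<rho>})
           \<le> (2 * \<rho> + 3) ^ DIM('a) * (2 ^ n) ^ DIM('a)"
proof -
  let ?Z = "{z \<in> range (grid_point n). norm (z::'a) \<le> \<rho>}"
  define L where "L = \<lceil>2 ^ n * \<rho>\<rceil>"
  have L: "0 \<le> L" "real_of_int L \<le> 2 ^ n * \<rho> + 1"
    using assms by (auto simp: L_def zero_le_ceiling intro: less_le_trans[of _ 0])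
  define \<phi> where "\<phi> = (\<lambda>z::'a. restrict (\<lambda>b. \<lceil>2 ^ n * (z \<bullet> b)\<rceil>) Basis)"
  have inj: "inj_on \<phi> ?Z"
  proof (rule inj_onI)
    fix x y assume xy: "x \<in> ?Z" "y \<in> ?Z" "\<phi> x = \<phi> y"
    have "\<lceil>2 ^ n * (x \<bullet> b)\<rceil> = \<lceil>2 ^ n * (y \<bullet> b)\<rceil>" if "b \<in> Basis" for b
      using fun_cong[OF xy(3), of b] that by (simp add: \<phi>_def)
    then have "grid_point n x = grid_point n y"
      unfolding grid_point_eq_iff by blast
    moreover have "x \<in> range (grid_point n)" "y \<in> range (grid_point n)"
      using xy(1,2) by (simp_all only: mem_Collect_eq)
    ultimately show "x = y"
      by (simp only: grid_point_range)
  qed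
  have sub: "\<phi> ` ?Z \<subseteq> PiE Basis (\<lambda>_. {-L..L})"
  proof
    fix g assume "g \<in> \<phi> ` ?Z"
    then obtain z where z: "norm z \<le> \<rho>" "g = \<phi> z"
      by auto
    have "\<lceil>2 ^ n * (z \<bullet> b)\<rceil> \<in> {-L..L}" if "b \<in> Basis" for b
    proof -
      have "\<bar>2 ^ n * (z \<bullet> b)\<bar> \<le> 2 ^ n * \<rho>"
        using Basis_le_norm[OF that, of z] z by (simp add: abs_mult)
      then show ?thesis
        unfolding L_def by (auto simp: le_ceiling_iff ceiling_le_iff) linarith+
    qed
    then show "g \<in> PiE Basis (\<lambda>_. {-L..L})"
      by (auto simp: z \<phi>_def)
  qed
  have fin: "finite (PiE (Basis::'a set) (\<lambda>_. {-L..L}))"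
    by (simp add: finite_PiE)
  show "finite ?Z"
    using inj sub fin by (meson finite_imageD finite_subset)
  have "card ?Z \<le> card (PiE (Basis::'a set) (\<lambda>_. {-L..L}))"
    using card_inj_on_le[OF inj sub fin] .
  also have "\<dots> = nat (2 * L + 1) ^ DIM('a)"
    by (simp add: card_PiE algebra_simps)
  finally have "real (card ?Z) \<le> real (nat (2 * L + 1)) ^ DIM('a)"
    by (metis of_nat_le_iff of_nat_power)
  also have "\<dots> \<le> ((2 * \<rho> + 3) * 2 ^ n) ^ DIM('a)"
  proof (rule power_mono)
    have "real (nat (2 * L + 1)) \<le> 2 * (2 ^ n * \<rho>) + 3"
      using L by simp
    also have "\<dots> \<le> (2 * \<rho> + 3) * 2 ^ n"
      using one_le_power[of "2::real" n] by (simp add: algebra_simps)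
    finally show "real (nat (2 * L + 1)) \<le> (2 * \<rho> + 3) * 2 ^ n" .
  qed simp
  finally show "real (card ?Z) \<le> (2 * \<rho> + 3) ^ DIM('a) * (2 ^ n) ^ DIM('a)"
    by (simp add: power_mult_distrib)
qed

text \<open>Translation by \<open>z\<close> and scaling by \<open>1 / \<delta>\<close> bring
  \<open>X\<close> into one fixed ball, which finitely many balls of radius \<open>a / 2\<close>
  cover; each of these receives at most one point. Hence \<open>M\<close> serves all centres and all
  scales at once.\<close>

lemma packing_bound:
  assumes "0 < a"
  obtains M :: nat where "\<And>(z::'a::euclidean_space) \<delta> X. \<lbrakk>0 < \<delta>; X \<subseteq> cball z (b * \<delta>);
    \<And>x y. \<lbrakk>x \<in> X; y \<in> X; x \<noteq> y\<rbrakk> \<Longrightarrow> a * \<delta> \<le> dist x y\<rbrakk> \<Longrightarrow> finite X \<and> card X \<le> M"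
proof -
  have "compact (cball (0::'a) b)"
    by simp
  then obtain k where k: "finite k" "cball (0::'a) b \<subseteq> (\<Union>c\<in>k. ball c (a / 2))"
    using assms compact_imp_seq_compact seq_compact_imp_totally_bounded half_gt_zero by metis
  have "finite X \<and> card X \<le> card k"
    if d: "0 < \<delta>" and X: "X \<subseteq> cball z (b * \<delta>)"
      and sep: "\<And>x y. \<lbrakk>x \<in> X; y \<in> X; x \<noteq> y\<rbrakk> \<Longrightarrow> a * \<delta> \<le> dist x y" for z :: 'a and \<delta> X
  proof -
    have "\<exists>c\<in>k. (1 / \<delta>) *\<^sub>R (x - z) \<in> ball c (a / 2)" if "x \<in> X" for x
    proof -
      have "dist z x \<le> b * \<delta>"
        using X that by auto
      then have "(1 / \<delta>) *\<^sub>R (x - z) \<in> cball 0 b"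
        using d by (simp add: dist_norm norm_minus_commute mult.commute divide_le_eq del: scaleR_right_diff_distrib)
      then show ?thesis
        using k(2) by blast
    qed
    then obtain \<phi> where \<phi>: "\<And>x. x \<in> X \<Longrightarrow> \<phi> x \<in> k \<and> (1 / \<delta>) *\<^sub>R (x - z) \<in> ball (\<phi> x) (a / 2)"
      by metis
    have "inj_on \<phi> X"
    proof (rule inj_onI, rule ccontr)
      fix x y assume xy: "x \<in> X" "y \<in> X" "\<phi> x = \<phi> y" "x \<noteq> y"
      then have "dist (\<phi> x) ((1 / \<delta>) *\<^sub>R (x - z)) < a / 2" "dist (\<phi> x) ((1 / \<delta>) *\<^sub>R (y - z)) < a / 2"
        using \<phi>[of x] \<phi>[of y] by auto
      then have "dist ((1 / \<delta>) *\<^sub>R (x - z)) ((1 / \<delta>) *\<^sub>R (y - z)) < a"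
        by metric
      moreover have "dist ((1 / \<delta>) *\<^sub>R (x - z)) ((1 / \<delta>) *\<^sub>R (y - z)) = dist x y / \<delta>"
        using d by (simp add: dist_norm scaleR_diff_right[symmetric])
      ultimately have "dist x y < a * \<delta>"
        using d by (simp only: pos_divide_less_eq)
      then show False
        using sep[of x y] xy by simp
    qed
    moreover have "\<phi> ` X \<subseteq> k"
      using \<phi> by auto
    ultimately show ?thesis
      using k(1) card_inj_on_le inj_on_finite by blast
  qed
  then show ?thesis
    using that by blast
qed

text \<open>With \<open>T\<close> the total, \<open>a i \<le> T\<close> and
  \<open>q - 1 \<le> 0\<close> give \<open>a i * T powr (q - 1) \<le> a i powr q\<close>; sum over
  \<open>i\<close>. Over an infinite index set both sums are 0.\<close>

lemma sum_powr_subadditive: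
  fixes a :: "'b \<Rightarrow> real"
  assumes "0 \<le> q" "q \<le> 1" and nonneg: "\<And>i. i \<in> I \<Longrightarrow> 0 \<le> a i"
  shows "sum a I powr q \<le> (\<Sum>i\<in>I. a i powr q)"
proof (cases "finite I")
  case True
  define T where "T = sum a I"
  have T: "0 \<le> T"
    by (simp add: T_def nonneg sum_nonneg)
  have le: "a i * T powr (q - 1) \<le> a i powr q" if "i \<in> I" for i
  proof (cases "a i = 0")
    case False
    have ai: "0 < a i" "a i \<le> T"
      using False nonneg[OF that] less_eq_real_def[of 0 "a i"] member_le_sum[of i I a] nonneg that True by (auto simp: T_def)
    then have "T powr (q - 1) \<le> a i powr (q - 1)"
      using assms by (intro powr_mono2') auto
    then have "a i * T powr (q - 1) \<le> a i * a i powr (q - 1)"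
      using ai by (intro mult_left_mono) auto
    also have "\<dots> = a i powr q"
      using ai by (simp add: powr_diff)
    finally show ?thesis .
  qed simp
  have "T powr q = T * T powr (q - 1)"
    using T by (cases "T = 0") (auto simp: powr_diff)
  also have "\<dots> = (\<Sum>i\<in>I. a i * T powr (q - 1))"
    by (simp add: T_def sum_distrib_right)
  also have "\<dots> \<le> (\<Sum>i\<in>I. a i powr q)"
    by (rule sum_mono) (rule le)
  finally show ?thesis
    by (simp add: T_def)
qed simp

subsection \<open>Moment sums of bounded measures\<close>

text \<open>Cells of positive mass are represented by their corners. These are
  \<open>1 / 2 ^ n\<close>-separated, so packing bounds apply to cells directly.\<close>

definition charged :: "'a::euclidean_space measure \<Rightarrow> nat \<Rightarrow> 'a set" where
  "charged \<eta> n = {z \<in> range (grid_point n). 0 < measure \<eta> (cell n z)}"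

definition lq_sum :: "'a::euclidean_space measure \<Rightarrow> real \<Rightarrow> nat \<Rightarrow> real" where
  "lq_sum \<eta> q n = (\<Sum>z\<in>charged \<eta> n. measure \<eta> (cell n z) powr q)"

text \<open>Compact support enters in the form of full mass on a ball around the origin.\<close>

locale bounded_borel_prob = prob_space \<eta> for \<eta> :: "'a::euclidean_space measure" +
  fixes R :: real
  assumes sets_eq [measurable_cong]: "sets \<eta> = sets borel"
    and R_nonneg: "0 \<le> R"
    and conc: "prob (cball 0 R) = 1"
begin

lemma space_eq [simp]: "space \<eta> = UNIV"
  using sets_eq_imp_space_eq[OF sets_eq] by simp

lemma cell_sets [simp]: "cell n x \<in> events"
  by (simp add: sets_eq cell_borel)

lemma cball_sets [simp]: "cball x s \<in> events"
  by (simp add: sets_eq)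

lemma AE_cball: "AE x in \<eta>. x \<in> cball 0 R"
  using conc prob_eq_1 by simp

lemma prob_null:
  assumes "A \<inter> cball 0 R = {}" "A \<in> events"
  shows "prob A = 0"
proof -
  have "prob (A \<union> cball 0 R) = prob A + prob (cball 0 R)"
    using assms by (intro finite_measure_Union) auto
  then show ?thesis
    using prob_le_1[of "A \<union> cball 0 R"] measure_nonneg[of \<eta> A] conc by simp
qed

lemma charged_norm:
  assumes "z \<in> charged \<eta> n"
  shows "norm z \<le> R + DIM('a)"
proof -
  have "cell n z \<inter> cball 0 R \<noteq> {}"
    using assms prob_null[of "cell n z"] by (auto simp: charged_def)
  then obtain y where y: "y \<in> cell n z" "norm y \<le> R"
    by auto
  moreover have "grid_point n y = z"
    using y assms cell_range_eq by (auto simp: charged_def)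
  ultimately have "dist y z \<le> DIM('a) / 2 ^ n"
    using dist_grid_point[of y n] by simp
  also have "\<dots> \<le> DIM('a)"
    using one_le_power[of "2::real" n] by (simp add: divide_le_eq mult_le_cancel_left1)
  finally show ?thesis
    using y norm_triangle_sub[of z y] by (simp add: dist_norm norm_minus_commute)
qed

lemma charged_subset: "charged \<eta> n \<subseteq> {z \<in> range (grid_point n). norm z \<le> R + DIM('a)}"
  using charged_norm by (auto simp: charged_def)

lemma finite_charged [simp]: "finite (charged \<eta> n)"
  using finite_subset[OF charged_subset grid_count(1)] R_nonneg by simp

lemma card_charged: "real (card (charged \<eta> n)) \<le> (2 * (R + DIM('a)) + 3) ^ DIM('a) * (2 ^ n) ^ DIM('a)"
proof -
  have "card (charged \<eta> n) \<le> card {z \<in> range (grid_point n). norm (z::'a) \<le> R + DIM('a)}"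
    using R_nonneg by (intro card_mono charged_subset grid_count(1)) simp
  then have "real (card (charged \<eta> n)) \<le> real (card {z \<in> range (grid_point n). norm (z::'a) \<le> R + DIM('a)})"
    by (simp only: of_nat_le_iff)
  also have "\<dots> \<le> (2 * (R + DIM('a)) + 3) ^ DIM('a) * (2 ^ n) ^ DIM('a)"
    using R_nonneg by (intro grid_count(2)) simp
  finally show ?thesis .
qed

lemma charged_separated:
  "x \<in> charged \<eta> n \<Longrightarrow> y \<in> charged \<eta> n \<Longrightarrow> x \<noteq> y \<Longrightarrow> 1 / 2 ^ n \<le> dist x y"
  by (rule grid_separated) (auto simp: charged_def)

lemma disjoint_cells: "disjoint_family_on (cell n) (charged \<eta> n)"
  unfolding disjoint_family_on_def
  by (metis (mono_tags, lifting) cell_def charged_def disjoint_iff grid_point_range mem_Collect_eq)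

text \<open>Only finitely many corners come close to the ball of full mass, so the uncharged cells
  that could contain a point of it form a finite union of null sets.\<close>

lemma AE_charged: "AE x in \<eta>. grid_point n x \<in> charged \<eta> n"
proof -
  let ?G = "{z \<in> range (grid_point n). norm (z::'a) \<le> R + DIM('a)}"
  have fin: "finite ?G"
    using R_nonneg by (intro grid_count(1)) simp
  have "AE x in \<eta>. x \<notin> cell n z" if "z \<in> ?G - charged \<eta> n" for z
    using that by (intro AE_not_in) (simp add: null_sets_def emeasure_eq_measure charged_def zero_less_measure_iff)
  then have "AE x in \<eta>. \<forall>z\<in>?G - charged \<eta> n. x \<notin> cell n z"
    using fin by (subst AE_finite_all) auto
  with AE_cball show ?thesis
  proof eventually_elim
    case (elim x)
    have "dist x (grid_point n x) \<le> DIM('a)"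
      by (rule order_trans[OF dist_grid_point])
         (use one_le_power[of "2::real" n] in \<open>simp add: divide_le_eq mult_le_cancel_left1\<close>)
    then have "norm (grid_point n x) \<le> R + DIM('a)"
      using elim(1) norm_triangle_sub[of "grid_point n x" x] by (simp add: dist_norm norm_minus_commute)
    then have "x \<notin> cell n (grid_point n x)" if "grid_point n x \<notin> charged \<eta> n"
      using elim(2) that by blast
    then show ?case
      by auto
  qed
qed

lemma prob_le_sum_cells:
  assumes "A \<in> events"
  shows "prob A \<le> (\<Sum>z\<in>{z \<in> charged \<eta> n. cell n z \<inter> A \<noteq> {}}. prob (cell n z))"
proof -
  let ?Z = "{z \<in> charged \<eta> n. cell n z \<inter> A \<noteq> {}}"
  have "prob A \<le> prob (\<Union>z\<in>?Z. cell n z)"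
  proof (rule finite_measure_mono_AE)
    show "AE x\<in>A in \<eta>. x \<in> (\<Union>z\<in>?Z. cell n z)"
      using AE_charged[of n]
    proof eventually_elim
      case (elim x)
      have "x \<in> cell n (grid_point n x)"
        by simp
      then show ?case
        using elim by blast
    qed
  qed (auto intro!: sets.finite_UN)
  also have "\<dots> \<le> (\<Sum>z\<in>?Z. prob (cell n z))"
    by (rule finite_measure_subadditive_finite) auto
  finally show ?thesis .
qed

lemma sum_charged: "(\<Sum>z\<in>charged \<eta> n. prob (cell n z)) = 1"
proof (rule antisym)
  have "(\<Sum>z\<in>charged \<eta> n. prob (cell n z)) = prob (\<Union>z\<in>charged \<eta> n. cell n z)"
    by (rule finite_measure_finite_Union[symmetric]) (auto simp: disjoint_cells)
  then show "(\<Sum>z\<in>charged \<eta> n. prob (cell n z)) \<le> 1"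
    by simp
  have "{z \<in> charged \<eta> n. cell n z \<inter> UNIV \<noteq> {}} = charged \<eta> n"
    using mem_cell_self by blast
  then show "1 \<le> (\<Sum>z\<in>charged \<eta> n. prob (cell n z))"
    using prob_le_sum_cells[of UNIV n] prob_space sets.top by (metis (no_types, lifting) space_eq)
qed

lemma charged_nonempty: "charged \<eta> n \<noteq> {}"
  using sum_charged[of n] by auto

text \<open>Masses are at most 1, so lowering the exponent from 1 to \<open>q\<close> increases each
  summand of a sum equal to 1.\<close>

lemma lq_sum_ge_1:
  assumes "q \<le> 1"
  shows "1 \<le> lq_sum \<eta> q n"
proof -
  have "1 = (\<Sum>z\<in>charged \<eta> n. prob (cell n z) powr 1)"
    using sum_charged[of n] by simp
  also have "\<dots> \<le> lq_sum \<eta> q n"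
    unfolding lq_sum_def by (intro sum_mono powr_mono') (auto simp: assms)
  finally show ?thesis .
qed

lemma lq_sum_antimono: "q \<le> q' \<Longrightarrow> lq_sum \<eta> q' n \<le> lq_sum \<eta> q n"
  unfolding lq_sum_def by (intro sum_mono powr_mono') auto

text \<open>Since \<open>0 powr q = 0\<close>, the uncharged cells drop out of the infinite sum and
  a finite one remains.\<close>

lemma lq_approx_eq: "lq_approx \<eta> q n = ln (lq_sum \<eta> q n) / ln (2 ^ n)"
proof -
  have "(\<Sum>\<^sub>\<infinity>C\<in>dyadic_cubes n. prob C powr q) =
      (\<Sum>\<^sub>\<infinity>z\<in>range (grid_point n). prob (cell n z) powr q)"
    unfolding dyadic_cubes_eq by (subst infsum_reindex[OF inj_on_cell]) (simp add: o_def)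
  also have "\<dots> = (\<Sum>\<^sub>\<infinity>z\<in>charged \<eta> n. prob (cell n z) powr q)"
    by (rule infsum_cong_neutral) (auto simp: charged_def zero_less_measure_iff)
  also have "\<dots> = lq_sum \<eta> q n"
    by (simp add: lq_sum_def)
  finally show ?thesis
    by (simp add: lq_approx_def)
qed

text \<open>A cheap substitute for Jensen's inequality: compare the mass of each cell with the
  reciprocal of the number of charged cells.\<close>

lemma lq_sum_le_card:
  assumes "0 < q" "q \<le> 1"
  shows "lq_sum \<eta> q n \<le> 2 * real (card (charged \<eta> n)) powr (1 - q)"
proof -
  define k where "k = real (card (charged \<eta> n))"
  have k: "0 < k"
    using charged_nonempty finite_charged by (simp add: k_def card_gt_0_iff)
  have "prob (cell n z) powr q \<le> k powr (1 - q) * prob (cell n z) + k powr (- q)"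
    if "z \<in> charged \<eta> n" for z
  proof -
    define m where "m = prob (cell n z)"
    have m: "0 < m"
      using that by (simp add: m_def charged_def)
    have "m powr q \<le> k powr (1 - q) * m + k powr (- q)"
    proof (cases "1 / k \<le> m")
      case True
      have "m powr q = m * m powr (q - 1)"
        using m by (simp add: powr_diff)
      also have "\<dots> \<le> m * (1 / k) powr (q - 1)"
        using True m k assms by (intro mult_left_mono powr_mono2') auto
      also have "\<dots> = k powr (1 - q) * m"
        using k by (simp add: powr_divide powr_minus[symmetric] divide_powr_uminus)
      finally show ?thesis
        by (smt (verit) powr_ge_zero)
    next
      case False
      then have "m powr q \<le> (1 / k) powr q"
        using m k assms by (intro powr_mono2) auto
      also have "\<dots> = k powr (- q)"
        using k by (simp add: powr_divide divide_powr_uminus)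
      finally show ?thesis
        using m by (smt (verit) powr_ge_zero mult_nonneg_nonneg)
    qed
    then show ?thesis
      by (simp add: m_def)
  qed
  then have "lq_sum \<eta> q n \<le> (\<Sum>z\<in>charged \<eta> n. k powr (1 - q) * prob (cell n z) + k powr (- q))"
    unfolding lq_sum_def by (rule sum_mono)
  also have "\<dots> = k powr (1 - q) + k * k powr (- q)"
    by (simp add: sum.distrib sum_distrib_left[symmetric] sum_charged k_def)
  also have "k * k powr (- q) = k powr (1 - q)"
    using k by (simp add: powr_diff powr_minus divide_simps)
  finally show ?thesis
    by (simp add: k_def)
qed

text \<open>The number of charged cells is at most a constant times
  \<open>(2 ^ n) ^ DIM('a)\<close>. The resulting bound \<open>DIM('a) * (1 - q)\<close> on the
  spectrum tends to 0 as \<open>q\<close> tends to 1, which later forces \<open>q_crit\<close> below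
  1.\<close>

lemma lq_sum_dim_bound:
  fixes q :: real
  assumes "0 < q" "q \<le> 1"
  obtains K where "0 < K" "\<And>n. lq_sum \<eta> q n \<le> K * (2 ^ n) powr (DIM('a) * (1 - q))"
proof -
  define C where "C = (2 * (R + DIM('a)) + 3) ^ DIM('a)"
  have C: "0 < C"
    unfolding C_def using R_nonneg by (intro zero_less_power) simp
  have "lq_sum \<eta> q n \<le> 2 * C powr (1 - q) * (2 ^ n) powr (DIM('a) * (1 - q))" for n
  proof -
    have "lq_sum \<eta> q n \<le> 2 * real (card (charged \<eta> n)) powr (1 - q)"
      by (rule lq_sum_le_card) fact+
    also have "\<dots> \<le> 2 * (C * (2 ^ n) ^ DIM('a)) powr (1 - q)"
      using card_charged[of n] assms unfolding C_def by (intro mult_left_mono powr_mono2) auto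
    also have "\<dots> = 2 * C powr (1 - q) * (2 ^ n) powr (DIM('a) * (1 - q))"
      using C by (simp add: powr_mult powr_powr[symmetric] powr_realpow[symmetric])
    finally show ?thesis .
  qed
  then show ?thesis
    using that[of "2 * C powr (1 - q)"] C by simp
qed

text \<open>Up to a null set each ball is covered by the charged cells it meets, the power
  \<open>q\<close> distributes over this cover by subadditivity, and by packing a cell meets
  boundedly many of the balls.\<close>

lemma ball_sum_le_lq_sum:
  assumes "0 < a" "0 < q" "q \<le> 1"
  obtains K where "0 < K" and "\<And>n X. \<lbrakk>finite X; \<And>x y. \<lbrakk>x \<in> X; y \<in> X; x \<noteq> y\<rbrakk> \<Longrightarrow> a / 2 ^ n \<le> dist x y\<rbrakk>
    \<Longrightarrow> (\<Sum>x\<in>X. prob (cball x (b / 2 ^ n)) powr q) \<le> K * lq_sum \<eta> q n"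
proof -
  obtain M :: nat where M: "\<And>(z::'a) \<delta> X. \<lbrakk>0 < \<delta>; X \<subseteq> cball z ((b + DIM('a)) * \<delta>);
      \<And>x y. \<lbrakk>x \<in> X; y \<in> X; x \<noteq> y\<rbrakk> \<Longrightarrow> a * \<delta> \<le> dist x y\<rbrakk> \<Longrightarrow> finite X \<and> card X \<le> M"
    using packing_bound[OF assms(1)] by metis
  \<comment> \<open>\<open>Suc M\<close> replaces \<open>M\<close> so that the constant is
    positive.\<close>
  have "(\<Sum>x\<in>X. prob (cball x (b / 2 ^ n)) powr q) \<le> real (Suc M) * lq_sum \<eta> q n"
    if X: "finite X" and sep: "\<And>x y. \<lbrakk>x \<in> X; y \<in> X; x \<noteq> y\<rbrakk> \<Longrightarrow> a / 2 ^ n \<le> dist x y" for n X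
  proof -
    let ?m = "\<lambda>z. prob (cell n z)"
    let ?rel = "\<lambda>x z. cell n z \<inter> cball x (b / 2 ^ n) \<noteq> {}"
    have "(\<Sum>x\<in>X. prob (cball x (b / 2 ^ n)) powr q)
        \<le> (\<Sum>x\<in>X. \<Sum>z\<in>{z \<in> charged \<eta> n. ?rel x z}. ?m z powr q)"
    proof (rule sum_mono)
      fix x
      have "prob (cball x (b / 2 ^ n)) powr q \<le> (\<Sum>z\<in>{z \<in> charged \<eta> n. ?rel x z}. ?m z) powr q"
        using assms by (intro powr_mono2 prob_le_sum_cells) auto
      also have "\<dots> \<le> (\<Sum>z\<in>{z \<in> charged \<eta> n. ?rel x z}. ?m z powr q)"
        using assms by (intro sum_powr_subadditive) auto
      finally show "prob (cball x (b / 2 ^ n)) powr q \<le> (\<Sum>z\<in>{z \<in> charged \<eta> n. ?rel x z}. ?m z powr q)" .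
    qed
    also have "\<dots> = (\<Sum>z\<in>charged \<eta> n. \<Sum>x\<in>{x \<in> X. ?rel x z}. ?m z powr q)"
      using X by (intro sum.swap_restrict) auto
    also have "\<dots> \<le> (\<Sum>z\<in>charged \<eta> n. real (Suc M) * ?m z powr q)"
    proof (rule sum_mono)
      fix z assume z: "z \<in> charged \<eta> n"
      have "{x \<in> X. ?rel x z} \<subseteq> cball z ((b + DIM('a)) * (1 / 2 ^ n))"
      proof
        fix x assume "x \<in> {x \<in> X. ?rel x z}"
        then obtain y where y: "y \<in> cell n z" "dist x y \<le> b / 2 ^ n"
          by auto
        moreover have "grid_point n y = z"
          using y z cell_range_eq by (auto simp: charged_def)
        ultimately have "dist y z \<le> DIM('a) / 2 ^ n"
          using dist_grid_point[of y n] by simp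
        then have "dist z x \<le> b / 2 ^ n + DIM('a) / 2 ^ n"
          using y(2) dist_triangle[of z x y] by (simp add: dist_commute)
        then show "x \<in> cball z ((b + DIM('a)) * (1 / 2 ^ n))"
          by (simp add: add_divide_distrib)
      qed
      then have "card {x \<in> X. ?rel x z} \<le> M"
        using M[of "1 / 2 ^ n" "{x \<in> X. ?rel x z}" z] sep by auto
      then show "(\<Sum>x\<in>{x \<in> X. ?rel x z}. ?m z powr q) \<le> real (Suc M) * ?m z powr q"
        by (simp add: mult_right_mono)
    qed
    also have "\<dots> = real (Suc M) * lq_sum \<eta> q n"
      by (simp add: lq_sum_def sum_distrib_left)
    finally show ?thesis .
  qed
  then show ?thesis
    using that[of "real (Suc M)"] by simp
qed

text \<open>A cell lies in the ball of radius \<open>DIM('a) / 2 ^ n\<close> around its corner. With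
  \<open>ball_sum_le_lq_sum\<close> this makes sums over cells and over balls with separated centres
  comparable; balls, unlike cells, are preserved by similitudes.\<close>

lemma lq_sum_le_ball_sum:
  assumes "0 \<le> q"
  shows "lq_sum \<eta> q n \<le> (\<Sum>z\<in>charged \<eta> n. prob (cball z (DIM('a) / 2 ^ n)) powr q)"
  unfolding lq_sum_def
proof (intro sum_mono powr_mono2 finite_measure_mono)
  fix z assume "z \<in> charged \<eta> n"
  then have "cell n z = {y. grid_point n y = z}"
    by (intro cell_range_eq) (simp add: charged_def)
  then show "cell n z \<subseteq> cball z (DIM('a) / 2 ^ n)"
    using dist_grid_point by (auto simp: dist_commute)
qed (auto simp: assms)

end

subsection \<open>Growth rates\<close>

lemma powr_two_power: "(2 ^ n) powr s = exp (s * (real n * ln 2))" for s :: real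
  by (simp add: powr_def ln_realpow)

lemma eventually_le_powr:
  fixes S :: "nat \<Rightarrow> real"
  assumes "\<forall>\<^sub>F n in sequentially. ln (S n) / ln (2 ^ n) < s" "\<And>n. 0 < S n"
  shows "\<forall>\<^sub>F n in sequentially. S n \<le> (2 ^ n) powr s"
  using assms(1) eventually_gt_at_top[of 0]
proof eventually_elim
  case (elim n)
  then have "ln (S n) < s * (real n * ln 2)"
    by (simp add: ln_realpow divide_less_eq)
  then have "exp (ln (S n)) \<le> exp (s * (real n * ln 2))"
    by simp
  then show ?case
    using assms(2)[of n] by (simp add: powr_two_power)
qed

lemma eventually_ge_powr:
  fixes S :: "nat \<Rightarrow> real"
  assumes "\<forall>\<^sub>F n in sequentially. s < ln (S n) / ln (2 ^ n)" "\<And>n. 0 < S n"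
  shows "\<forall>\<^sub>F n in sequentially. (2 ^ n) powr s \<le> S n"
  using assms(1) eventually_gt_at_top[of 0]
proof eventually_elim
  case (elim n)
  then have "s * (real n * ln 2) < ln (S n)"
    by (simp add: ln_realpow less_divide_eq)
  then have "exp (s * (real n * ln 2)) \<le> exp (ln (S n))"
    by simp
  then show ?case
    using assms(2)[of n] by (simp add: powr_two_power)
qed

text \<open>The finitely many early indices are absorbed by adding all their ratios
  \<open>\<bar>S i\<bar> / g i\<close> to 1.\<close>

lemma eventually_le_imp_le_mult:
  fixes S g :: "nat \<Rightarrow> real"
  assumes "\<forall>\<^sub>F n in sequentially. S n \<le> g n" "\<And>n. 0 < g n"
  obtains K where "0 < K" "\<And>n. S n \<le> K * g n"
proof -
  obtain m where m: "\<And>n. m \<le> n \<Longrightarrow> S n \<le> g n"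
    using assms(1) by (auto simp: eventually_sequentially)
  define K where "K = 1 + (\<Sum>i<m. \<bar>S i\<bar> / g i)"
  have pos: "0 \<le> \<bar>S i\<bar> / g i" for i
    using assms(2)[of i] by simp
  have "1 \<le> K"
    by (simp add: K_def sum_nonneg pos)
  moreover have "S n \<le> K * g n" for n
  proof (cases "m \<le> n")
    case True
    have "g n \<le> K * g n"
      using \<open>1 \<le> K\<close> assms(2)[of n] by simp
    with m[OF True] show ?thesis
      by linarith
  next
    case False
    then have "\<bar>S n\<bar> / g n \<le> (\<Sum>i<m. \<bar>S i\<bar> / g i)"
      by (intro member_le_sum pos) auto
    then have "\<bar>S n\<bar> / g n \<le> K"
      by (simp add: K_def)
    then have "\<bar>S n\<bar> \<le> K * g n"
      using assms(2)[of n] by (simp add: divide_le_eq)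
    then show ?thesis
      by linarith
  qed
  ultimately show ?thesis
    by (intro that[of K]) auto
qed

lemma ln_over_scale_tendsto_0: "(\<lambda>n. K / ln (2 ^ n)) \<longlonglongrightarrow> (0::real)"
proof -
  have "(\<lambda>n. (K / ln 2) * (1 / real n)) \<longlonglongrightarrow> (K / ln 2) * 0"
    by (intro tendsto_mult tendsto_const lim_1_over_n)
  then show ?thesis
    by (simp add: ln_realpow mult.commute)
qed

text \<open>A multiplicative constant \<open>K\<close> contributes \<open>ln K / ln (2 ^ n)\<close>
  to the quotient, which tends to 0, so only the exponent survives.\<close>

lemma growth_rate_tendsto:
  fixes S :: "nat \<Rightarrow> real"
  assumes upper: "\<And>s. L < s \<Longrightarrow> \<exists>K>0. \<forall>n. S n \<le> K * (2 ^ n) powr s"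
    and lower: "\<And>s. s < L \<Longrightarrow> \<exists>K>0. \<forall>n. K * (2 ^ n) powr s \<le> S n"
  shows "(\<lambda>n. ln (S n) / ln (2 ^ n)) \<longlonglongrightarrow> L"
proof (rule order_tendstoI)
  \<comment> \<open>One lower bound is taken in advance: the logarithms can be compared only once
    \<open>S n\<close> is known to be positive.\<close>
  obtain K where K: "0 < K" "\<And>n. K * (2 ^ n) powr (L - 1) \<le> S n"
    using lower[of "L - 1"] by auto
  have pos: "0 < S n" for n
    by (rule less_le_trans[OF _ K(2)]) (use K(1) in simp)
  have expand: "ln (K * (2 ^ n) powr s) / ln (2 ^ n) = K' / ln (2 ^ n) + s"
    if "0 < K" "K' = ln K" "0 < n" for K K' s :: real and n
    using that by (simp add: ln_mult powr_two_power ln_realpow add_divide_distrib)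
  {
    fix a assume "a < L"
    then obtain s where s: "a < s" "s < L"
      using dense by blast
    then obtain K where K: "0 < K" "\<And>n. K * (2 ^ n) powr s \<le> S n"
      using lower by blast
    have "(\<lambda>n. ln K / ln (2 ^ n) + s) \<longlonglongrightarrow> 0 + s"
      by (intro tendsto_add ln_over_scale_tendsto_0 tendsto_const)
    then have "\<forall>\<^sub>F n in sequentially. a < ln K / ln (2 ^ n) + s"
      using s by (intro order_tendstoD(1)) auto
    then show "\<forall>\<^sub>F n in sequentially. a < ln (S n) / ln (2 ^ n)"
      using eventually_gt_at_top[of 0]
    proof eventually_elim
      case (elim n)
      have "ln (K * (2 ^ n) powr s) \<le> ln (S n)"
        using K by (subst ln_le_cancel_iff) (auto simp: pos)
      then have "ln (K * (2 ^ n) powr s) / ln (2 ^ n) \<le> ln (S n) / ln (2 ^ n)"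
        by (rule divide_right_mono) simp
      then show ?case
        using elim expand[of K "ln K" n s] K by simp
    qed
  }
  {
    fix a assume "L < a"
    then obtain s where s: "L < s" "s < a"
      using dense by blast
    then obtain K where K: "0 < K" "\<And>n. S n \<le> K * (2 ^ n) powr s"
      using upper by blast
    have "(\<lambda>n. ln K / ln (2 ^ n) + s) \<longlonglongrightarrow> 0 + s"
      by (intro tendsto_add ln_over_scale_tendsto_0 tendsto_const)
    then have "\<forall>\<^sub>F n in sequentially. ln K / ln (2 ^ n) + s < a"
      using s by (intro order_tendstoD(2)) auto
    then show "\<forall>\<^sub>F n in sequentially. ln (S n) / ln (2 ^ n) < a"
      using eventually_gt_at_top[of 0]
    proof eventually_elim
      case (elim n)
      have "ln (S n) \<le> ln (K * (2 ^ n) powr s)"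
        using K pos[of n] by (subst ln_le_cancel_iff) auto
      then have "ln (S n) / ln (2 ^ n) \<le> ln (K * (2 ^ n) powr s) / ln (2 ^ n)"
        by (rule divide_right_mono) simp
      then show ?case
        using elim expand[of K "ln K" n s] K by simp
    qed
  }
qed

section \<open>Limits of the moment exponents\<close>

context bounded_borel_prob
begin

lemma lq_sum_pos: "q \<le> 1 \<Longrightarrow> 0 < lq_sum \<eta> q n"
  using lq_sum_ge_1[of q n] by linarith

lemma lq_sum_upper:
  assumes "lq_approx \<eta> q \<longlonglongrightarrow> \<beta>" "q \<le> 1" "\<beta> < s"
  obtains K where "0 < K" "\<And>n. lq_sum \<eta> q n \<le> K * (2 ^ n) powr s"
proof (rule eventually_le_imp_le_mult)
  show "\<forall>\<^sub>F n in sequentially. lq_sum \<eta> q n \<le> (2 ^ n) powr s"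
    using order_tendstoD(2)[OF assms(1,3)] assms(2)
    by (intro eventually_le_powr) (auto simp: lq_approx_eq lq_sum_pos)
qed (auto intro: that)

lemma lq_sum_lower:
  assumes "lq_approx \<eta> q \<longlonglongrightarrow> \<beta>" "q \<le> 1" "s < \<beta>"
  obtains K where "0 < K" "\<And>n. K * (2 ^ n) powr s \<le> lq_sum \<eta> q n"
proof -
  have "\<forall>\<^sub>F n in sequentially. (2 ^ n) powr s \<le> lq_sum \<eta> q n"
    using order_tendstoD(1)[OF assms(1,3)] assms(2)
    by (intro eventually_ge_powr) (auto simp: lq_approx_eq lq_sum_pos)
  then obtain K where K: "0 < K" "\<And>n. (2 ^ n) powr s \<le> K * lq_sum \<eta> q n"
    by (rule eventually_le_imp_le_mult) (auto simp: lq_sum_pos[OF assms(2)])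
  have "1 / K * (2 ^ n) powr s \<le> lq_sum \<eta> q n" for n
    using K(1) K(2)[of n] by (simp add: divide_le_eq mult.commute)
  then show ?thesis
    using K(1) by (intro that[of "1 / K"]) auto
qed

lemma lq_approx_nonneg: "q \<le> 1 \<Longrightarrow> 0 \<le> lq_approx \<eta> q n"
  using lq_sum_ge_1[of q n] by (simp add: lq_approx_eq)

lemma lq_approx_le:
  fixes q :: real
  assumes "0 < q" "q \<le> 1"
  obtains K where "0 < K" "\<And>n. 0 < n \<Longrightarrow> lq_approx \<eta> q n \<le> ln K / ln (2 ^ n) + DIM('a) * (1 - q)"
proof -
  obtain K where K: "0 < K" "\<And>n. lq_sum \<eta> q n \<le> K * (2 ^ n) powr (DIM('a) * (1 - q))"
    using lq_sum_dim_bound[OF assms] by blast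
  have "lq_approx \<eta> q n \<le> ln K / ln (2 ^ n) + DIM('a) * (1 - q)" if n: "0 < n" for n
  proof -
    have "ln (lq_sum \<eta> q n) \<le> ln (K * (2 ^ n) powr (DIM('a) * (1 - q)))"
      using K lq_sum_pos[of q n] assms by (subst ln_le_cancel_iff) auto
    also have "\<dots> = ln K + DIM('a) * (1 - q) * ln (2 ^ n)"
      using K by (simp add: ln_mult powr_two_power ln_realpow)
    finally have "lq_approx \<eta> q n \<le> (ln K + DIM('a) * (1 - q) * ln (2 ^ n)) / ln (2 ^ n)"
      unfolding lq_approx_eq by (rule divide_right_mono) simp
    also have "\<dots> = ln K / ln (2 ^ n) + DIM('a) * (1 - q)"
      using n by (simp add: add_divide_distrib ln_realpow)
    finally show ?thesis .
  qed
  then show ?thesis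
    using that K(1) by blast
qed

lemma lq_approx_limit_bounds:
  fixes q \<beta> :: real
  assumes "lq_approx \<eta> q \<longlonglongrightarrow> \<beta>" "0 < q" "q \<le> 1"
  shows "0 \<le> \<beta>" "\<beta> \<le> DIM('a) * (1 - q)"
proof -
  show "0 \<le> \<beta>"
    using assms by (intro LIMSEQ_le_const[OF assms(1)]) (auto simp: lq_approx_nonneg)
  obtain K where K: "\<And>n. 0 < n \<Longrightarrow> lq_approx \<eta> q n \<le> ln K / ln (2 ^ n) + DIM('a) * (1 - q)"
    using lq_approx_le[OF assms(2,3)] by blast
  have "(\<lambda>n. ln K / ln (2 ^ n) + DIM('a) * (1 - q)) \<longlonglongrightarrow> 0 + DIM('a) * (1 - q)"
    by (intro tendsto_add ln_over_scale_tendsto_0 tendsto_const)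
  then have "\<beta> \<le> 0 + DIM('a) * (1 - q)"
    by (rule LIMSEQ_le[OF assms(1)]) (use K in \<open>auto intro!: exI[of _ 1]\<close>)
  then show "\<beta> \<le> DIM('a) * (1 - q)"
    by simp
qed

text \<open>The spectrum is an extended real; the bounds on \<open>lq_approx\<close> make its value
  finite, so that the convergence becomes one of reals.\<close>

lemma lq_spectrum_limit:
  assumes "(\<lambda>n. ereal (lq_approx \<eta> q n)) \<longlonglongrightarrow> lq_spectrum \<eta> q" "0 < q" "q < 1"
  obtains \<beta> where "lq_spectrum \<eta> q = ereal \<beta>" "lq_approx \<eta> q \<longlonglongrightarrow> \<beta>"
proof -
  obtain K where K: "\<And>n. 0 < n \<Longrightarrow> lq_approx \<eta> q n \<le> ln K / ln (2 ^ n) + DIM('a) * (1 - q)"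
    using lq_approx_le[of q] assms by auto
  have "lq_approx \<eta> q n \<le> \<bar>ln K\<bar> / ln 2 + DIM('a) * (1 - q)" if "0 < n" for n
  proof -
    have "ln K / ln (2 ^ n) \<le> \<bar>ln K\<bar> / ln 2"
      using that by (intro frac_le) (auto simp: ln_realpow)
    with K[OF that] show ?thesis
      by linarith
  qed
  then have "lq_spectrum \<eta> q \<le> ereal (\<bar>ln K\<bar> / ln 2 + DIM('a) * (1 - q))"
    by (intro LIMSEQ_le_const2[OF assms(1)]) (auto intro!: exI[of _ 1])
  moreover have "0 \<le> lq_spectrum \<eta> q"
    using assms by (intro LIMSEQ_le_const[OF assms(1)]) (auto simp: lq_approx_nonneg)
  ultimately obtain \<beta> where "lq_spectrum \<eta> q = ereal \<beta>"
    by (cases "lq_spectrum \<eta> q") auto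
  then show ?thesis
    using that assms(1) by simp
qed

end

subsection \<open>Supports and similitudes\<close>

text \<open>The complement of the support is a union of open null sets, and by the Lindelof property
  countably many of them suffice.\<close>

lemma emeasure_outside_msupport:
  fixes \<eta> :: "'a::euclidean_space measure"
  assumes "sets \<eta> = sets borel"
  shows "emeasure \<eta> (- msupport \<eta>) = 0"
proof -
  define \<F> where "\<F> = {V. open V \<and> emeasure \<eta> V = 0}"
  obtain \<G> where G: "\<G> \<subseteq> \<F>" "countable \<G>" "\<Union>\<G> = \<Union>\<F>"
    using Lindelof[of \<F>] by (auto simp: \<F>_def)
  have "- msupport \<eta> = \<Union>\<F>"
    by (auto simp: msupport_def \<F>_def zero_less_iff_neq_zero)
  also have "\<dots> = (\<Union>V\<in>\<G>. V)"
    using G by simp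
  also have "emeasure \<eta> \<dots> = 0"
    using G by (intro null_setsD1 null_sets_UN') (auto simp: \<F>_def assms intro!: null_setsI)
  finally show ?thesis .
qed

lemma compactly_supported_imp_bounded_borel_prob:
  assumes "compactly_supported_borel_prob (\<eta> :: 'a::euclidean_space measure)"
  obtains R where "bounded_borel_prob \<eta> R"
proof -
  interpret prob_space \<eta>
    using assms by (simp add: compactly_supported_borel_prob_def)
  have sets: "sets \<eta> = sets borel" and comp: "compact (msupport \<eta>)"
    using assms by (auto simp: compactly_supported_borel_prob_def)
  obtain R where R: "0 < R" "\<And>x. x \<in> msupport \<eta> \<Longrightarrow> norm x \<le> R"
    using compact_imp_bounded[OF comp] bounded_pos by blast
  have "AE x in \<eta>. x \<notin> - msupport \<eta>"
    using emeasure_outside_msupport[OF sets] compact_imp_closed[OF comp]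
    by (intro AE_not_in null_setsI) (auto simp: sets)
  then have "AE x in \<eta>. x \<in> cball 0 R"
    by eventually_elim (use R in auto)
  then have "prob (cball 0 R) = 1"
    by (subst prob_eq_1) (auto simp: sets)
  then show ?thesis
    using that[of R] R by (simp add: bounded_borel_prob_def bounded_borel_prob_axioms_def sets prob_space_axioms)
qed

text \<open>Subtracting \<open>f 0\<close> and dividing by \<open>c\<close> leaves an isometry
  fixing the origin, which is an orthogonal transformation and therefore bijective.\<close>

lemma similitude_bij:
  fixes f :: "'a::euclidean_space \<Rightarrow> 'a"
  assumes "contractive_similitude c f"
  shows "bij f"
proof -
  have c: "0 < c" and d: "\<And>x y. dist (f x) (f y) = c * dist x y"
    using assms by (auto simp: contractive_similitude_def)
  define g where "g = (\<lambda>x. (1 / c) *\<^sub>R (f x - f 0))"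
  have "dist (g x) (g y) = dist x y" for x y
    using c d[of x y] by (simp add: g_def dist_norm scaleR_diff_right[symmetric])
  then have "orthogonal_transformation g"
    by (simp add: orthogonal_transformation_isometry g_def)
  then have "bij g"
    by (rule orthogonal_transformation_bij)
  moreover have "f = (\<lambda>y. f 0 + c *\<^sub>R y) \<circ> g"
    using c by (auto simp: g_def)
  moreover have "bij (\<lambda>y. f 0 + c *\<^sub>R y)"
    using c by (intro o_bij[where g = "\<lambda>y. (1 / c) *\<^sub>R (y - f 0)"]) auto
  ultimately show ?thesis
    by (metis bij_comp)
qed

lemma similitude_inv_dist:
  fixes f :: "'a::euclidean_space \<Rightarrow> 'a"
  assumes "contractive_similitude c f"
  shows "dist (inv f x) (inv f y) = dist x y / c"
  using assms similitude_bij[OF assms]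
  by (auto simp: contractive_similitude_def field_simps) (metis bij_inv_eq_iff)

lemma similitude_vimage_cball:
  fixes f :: "'a::euclidean_space \<Rightarrow> 'a"
  assumes "contractive_similitude c f"
  shows "f -` cball x s = cball (inv f x) (s / c)"
proof -
  have "dist x (f y) = c * dist (inv f x) y" for y
    using assms similitude_bij[OF assms] unfolding contractive_similitude_def
    by (metis bij_inv_eq_iff)
  then show ?thesis
    using assms by (auto simp: contractive_similitude_def field_simps)
qed

lemma similitude_borel:
  fixes f :: "'a::euclidean_space \<Rightarrow> 'a"
  assumes "contractive_similitude c f"
  shows "f \<in> borel_measurable borel"
proof -
  have "c-lipschitz_on UNIV f"
    using assms by (auto simp: contractive_similitude_def lipschitz_on_def)
  then show ?thesis
    by (intro borel_measurable_continuous_onI lipschitz_on_continuous_on)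
qed

subsection \<open>The spectrum of an inhomogeneous self-similar measure\<close>

text \<open>As a function of \<open>s\<close> it takes the value 1 at \<open>rho N p c q\<close>. A
  value below 1 makes the renewal step over scales contracting; a value of at least 1 lets lower
  bounds propagate.\<close>

definition pressure :: "nat \<Rightarrow> (nat \<Rightarrow> real) \<Rightarrow> (nat \<Rightarrow> real) \<Rightarrow> real \<Rightarrow> real \<Rightarrow> real" where
  "pressure N p c q s = (\<Sum>k=1..N. p k powr q * c k powr s)"

locale inhom_ifs = mu: bounded_borel_prob \<mu> R\<^sub>\<mu> + nu: bounded_borel_prob \<nu> R\<^sub>\<nu>
  for \<mu> \<nu> :: "'a::euclidean_space measure" and R\<^sub>\<mu> R\<^sub>\<nu> :: real +
  fixes N :: nat and f :: "nat \<Rightarrow> 'a \<Rightarrow> 'a" and c p :: "nat \<Rightarrow> real"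
  assumes sim: "i \<in> {1..N} \<Longrightarrow> contractive_similitude (c i) (f i)"
    and p_pos: "i \<in> {0..N} \<Longrightarrow> 0 < p i \<and> p i < 1"
    and p_sum: "(\<Sum>i=0..N. p i) = 1"
    and self_similar: "A \<in> sets borel \<Longrightarrow> measure \<nu> A =
      p 0 * measure \<mu> A + (\<Sum>i=1..N. p i * measure (distr \<nu> borel (f i)) A)"
begin

lemma N_pos: "1 \<le> N"
  using p_sum p_pos[of 0] by (cases N) auto

lemma c_pos: "i \<in> {1..N} \<Longrightarrow> 0 < c i" and c_less_1: "i \<in> {1..N} \<Longrightarrow> c i < 1"
  using sim by (auto simp: contractive_similitude_def)

definition "cmin = Min (c ` {1..N})"
definition "cmax = Max (c ` {1..N})"

lemma cmin_le: "i \<in> {1..N} \<Longrightarrow> cmin \<le> c i" and cmax_ge: "i \<in> {1..N} \<Longrightarrow> c i \<le> cmax"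
  by (auto simp: cmin_def cmax_def)

lemma cmin_cmax: "0 < cmin" "cmin < 1" "0 < cmax" "cmax < 1"
proof -
  have ne: "c ` {1..N} \<noteq> {}"
    using N_pos by simp
  show "0 < cmin" "cmax < 1"
    using ne c_pos c_less_1 by (auto simp: cmin_def cmax_def)
  show "cmin < 1" "0 < cmax"
    using cmin_le[of 1] cmax_ge[of 1] c_pos[of 1] c_less_1[of 1] N_pos by auto
qed

lemma nu_cball:
  "measure \<nu> (cball x s) =
    p 0 * measure \<mu> (cball x s) + (\<Sum>i=1..N. p i * measure \<nu> (cball (inv (f i) x) (s / c i)))"
proof -
  have "measure (distr \<nu> borel (f i)) (cball x s) = measure \<nu> (cball (inv (f i) x) (s / c i))"
    if "i \<in> {1..N}" for i
    using similitude_borel[OF sim[OF that]] similitude_vimage_cball[OF sim[OF that]]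
    by (subst measure_distr) (auto simp: measurable_cong_sets[OF nu.sets_eq refl])
  then show ?thesis
    by (subst self_similar) auto
qed

text \<open>Each step enlarges the scale by at least the factor \<open>1 / cmax > 1\<close>, so
  finitely many steps lead out of \<open>\<delta> < 1\<close>; since \<open>cmin \<le> c i\<close>,
  a step from below 1 cannot jump past \<open>1 / cmin\<close>.\<close>

lemma renewal_scale_induct [consumes 2, case_names base step]:
  assumes "0 < \<delta>" "\<delta> \<le> 1 / cmin"
    and base: "\<And>\<delta>. 1 \<le> \<delta> \<Longrightarrow> \<delta> \<le> 1 / cmin \<Longrightarrow> P \<delta>"
    and step: "\<And>\<delta>. \<lbrakk>0 < \<delta>; \<delta> < 1; \<And>i. i \<in> {1..N} \<Longrightarrow> P (\<delta> / c i)\<rbrakk> \<Longrightarrow> P \<delta>"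
  shows "P \<delta>"
proof -
  \<comment> \<open>\<open>k\<close> bounds the number of steps still needed to reach scale
    1.\<close>
  have "P \<delta>" if "cmax ^ k \<le> \<delta>" "0 < \<delta>" "\<delta> \<le> 1 / cmin" for k \<delta>
    using that
  proof (induction k arbitrary: \<delta>)
    case 0
    then show ?case
      using base by simp
  next
    case (Suc k)
    show ?case
    proof (cases "1 \<le> \<delta>")
      case True
      then show ?thesis
        using base Suc.prems by simp
    next
      case False
      have "P (\<delta> / c i)" if i: "i \<in> {1..N}" for i
      proof (rule Suc.IH)
        have "cmax ^ k \<le> \<delta> / cmax"
          using Suc.prems cmin_cmax by (simp add: field_simps)
        also have "\<dots> \<le> \<delta> / c i"
          using Suc.prems c_pos[OF i] cmax_ge[OF i] by (intro divide_left_mono) auto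
        finally show "cmax ^ k \<le> \<delta> / c i" .
        show "0 < \<delta> / c i"
          using Suc.prems c_pos[OF i] by simp
        show "\<delta> / c i \<le> 1 / cmin"
          using False cmin_cmax cmin_le[OF i] Suc.prems by (intro frac_le) auto
      qed
      then show ?thesis
        using step Suc.prems False by simp
    qed
  qed
  moreover obtain k where "cmax ^ k < \<delta>"
    using real_arch_pow_inv[OF assms(1) cmin_cmax(4)] by blast
  ultimately show ?thesis
    using assms by (meson less_imp_le)
qed

end

section \<open>Growth of ball sums under self-similarity\<close>

lemma exists_dyadic_scale:
  fixes \<delta> :: real
  assumes "0 < \<delta>" "\<delta> \<le> 1"
  obtains n where "1 / 2 ^ n \<le> \<delta>" "\<delta> \<le> 2 / 2 ^ n"
proof -
  define n where "n = (LEAST n. (1/2) ^ n \<le> \<delta>)"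
  obtain k where "(1/2) ^ k < \<delta>"
    using real_arch_pow_inv[OF assms(1), of "1/2"] by auto
  then have n: "(1/2) ^ n \<le> \<delta>"
    unfolding n_def using LeastI[of "\<lambda>n. (1/2) ^ n \<le> \<delta>" k] by simp
  \<comment> \<open>By minimality \<open>n - 1\<close> fails; for \<open>n = 0\<close> the
    hypothesis \<open>\<delta> \<le> 1\<close> gives the bound.\<close>
  have "\<delta> \<le> 2 * (1/2) ^ n"
  proof (cases n)
    case (Suc m)
    then have "\<not> (1/2) ^ m \<le> \<delta>"
      using not_less_Least[of m "\<lambda>n. (1/2) ^ n \<le> \<delta>"] by (simp add: n_def)
    then show ?thesis
      using Suc by simp
  qed (use assms in simp)
  then show ?thesis
    using that[of n] n by (simp add: power_one_over)
qed

text \<open>At a dyadic level with \<open>1 / 2 ^ n \<le> \<delta> \<le> 2 / 2 ^ n\<close> the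
  centres stay separated and the radius is at most \<open>2 * b / 2 ^ n\<close>; rounding the scale
  costs a factor \<open>2 powr s\<close>.\<close>

lemma (in bounded_borel_prob) ball_sum_upper:
  assumes "0 < q" "q \<le> 1" "0 \<le> s" "0 \<le> b" "\<And>n. lq_sum \<eta> q n \<le> K * (2 ^ n) powr s"
  obtains K' where "0 < K'" and "\<And>\<delta> X. \<lbrakk>0 < \<delta>; \<delta> \<le> 1; finite X;
      \<And>x y. \<lbrakk>x \<in> X; y \<in> X; x \<noteq> y\<rbrakk> \<Longrightarrow> \<delta> \<le> dist x y\<rbrakk>
    \<Longrightarrow> (\<Sum>x\<in>X. prob (cball x (b * \<delta>)) powr q) \<le> K' * \<delta> powr - s"
proof -
  obtain K1 where K1: "0 < K1" "\<And>n X. \<lbrakk>finite X; \<And>x y. \<lbrakk>x \<in> X; y \<in> X; x \<noteq> y\<rbrakk> \<Longrightarrow> 1 / 2 ^ n \<le> dist x y\<rbrakk>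
      \<Longrightarrow> (\<Sum>x\<in>X. prob (cball x (2 * b / 2 ^ n)) powr q) \<le> K1 * lq_sum \<eta> q n"
    using ball_sum_le_lq_sum[of 1 q "2 * b"] assms(1,2) by auto
  have K: "0 < K"
    using assms(5)[of 0] lq_sum_pos[OF assms(2), of 0] by simp
  have "(\<Sum>x\<in>X. prob (cball x (b * \<delta>)) powr q) \<le> K1 * K * 2 powr s * \<delta> powr - s"
    if d: "0 < \<delta>" "\<delta> \<le> 1" and X: "finite X" "\<And>x y. \<lbrakk>x \<in> X; y \<in> X; x \<noteq> y\<rbrakk> \<Longrightarrow> \<delta> \<le> dist x y" for \<delta> X
  proof -
    obtain n where n: "1 / 2 ^ n \<le> \<delta>" "\<delta> \<le> 2 / 2 ^ n"
      using exists_dyadic_scale d by blast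
    have "b * \<delta> \<le> 2 * b / 2 ^ n"
      using mult_left_mono[OF n(2) assms(4)] by (simp add: mult.commute)
    then have "(\<Sum>x\<in>X. prob (cball x (b * \<delta>)) powr q) \<le> (\<Sum>x\<in>X. prob (cball x (2 * b / 2 ^ n)) powr q)"
      using assms by (intro sum_mono powr_mono2 finite_measure_mono) auto
    also have "\<dots> \<le> K1 * lq_sum \<eta> q n"
      using X n(1) by (intro K1(2)) (auto intro: order_trans)
    also have "\<dots> \<le> K1 * (K * (2 ^ n) powr s)"
      using K1 assms(5) by (intro mult_left_mono) auto
    also have "\<dots> \<le> K1 * (K * (2 / \<delta>) powr s)"
      using K1 K n d assms by (intro mult_left_mono powr_mono2) (auto simp: field_simps)
    also have "\<dots> = K1 * K * 2 powr s * \<delta> powr - s"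
      using d by (simp add: powr_divide powr_minus_divide)
    finally show ?thesis .
  qed
  then show ?thesis
    using K1 K by (intro that[of "K1 * K * 2 powr s"]) auto
qed

context inhom_ifs
begin

text \<open>The ball sum at scale \<open>\<delta>\<close> is at most
  \<open>K1 * \<delta> powr - s\<close> plus the sum of \<open>p i powr q\<close> times ball sums at
  scale \<open>\<delta> / c i\<close>. A bound \<open>A * \<delta> powr - s\<close> reproduces
  itself once \<open>K1 + A * pressure N p c q s \<le> A\<close>, which is possible for pressure
  below 1.\<close>

lemma lq_sum_nu_upper:
  assumes q: "0 < q" "q \<le> 1" and s: "0 \<le> s" and contracting: "pressure N p c q s < 1"
    and K: "\<And>n. lq_sum \<mu> q n \<le> K * (2 ^ n) powr s"
  obtains K' where "0 < K'" "\<And>n. lq_sum \<nu> q n \<le> K' * (2 ^ n) powr s"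
proof -
  let ?d = "real DIM('a)"
  let ?sep = "\<lambda>(X::'a set) \<delta>. finite X \<and> (\<forall>x\<in>X. \<forall>y\<in>X. x \<noteq> y \<longrightarrow> \<delta> \<le> dist x y)"
  obtain K1 where K1: "0 < K1" "\<And>\<delta> X. \<lbrakk>0 < \<delta>; \<delta> \<le> 1; finite X;
      \<And>x y. \<lbrakk>x \<in> X; y \<in> X; x \<noteq> y\<rbrakk> \<Longrightarrow> \<delta> \<le> dist x y\<rbrakk>
      \<Longrightarrow> (\<Sum>x\<in>X. measure \<mu> (cball x (?d * \<delta>)) powr q) \<le> K1 * \<delta> powr - s"
    using mu.ball_sum_upper[OF q s _ K, of ?d] by auto
  obtain M :: nat where M: "\<And>(z::'a) \<delta> X. \<lbrakk>0 < \<delta>; X \<subseteq> cball z ((R\<^sub>\<nu> + ?d) * \<delta>);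
      \<And>x y. \<lbrakk>x \<in> X; y \<in> X; x \<noteq> y\<rbrakk> \<Longrightarrow> 1 * \<delta> \<le> dist x y\<rbrakk> \<Longrightarrow> finite X \<and> card X \<le> M"
    using packing_bound[of 1] zero_less_one by metis
  \<comment> \<open>The first entry settles the scales between 1 and \<open>1 / cmin\<close>, the
    second is the smallest value for which the renewal step closes.\<close>
  define A where "A = max (real M * cmin powr - s) (K1 / (1 - pressure N p c q s))"
  have A: "real M * cmin powr - s \<le> A" "K1 \<le> A * (1 - pressure N p c q s)"
    using contracting by (simp_all add: A_def pos_divide_le_eq[symmetric])
  have A0: "0 < A"
    using K1 contracting by (simp add: A_def less_max_iff_disj)
  have bound: "\<forall>X. ?sep X \<delta> \<longrightarrow> (\<Sum>x\<in>X. measure \<nu> (cball x (?d * \<delta>)) powr q) \<le> A * \<delta> powr - s"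
    if "0 < \<delta>" "\<delta> \<le> 1 / cmin" for \<delta>
    using that
  proof (induction \<delta> rule: renewal_scale_induct)
    case (base \<delta>)
    show ?case
    proof (intro allI impI)
      fix X :: "'a set" assume X: "?sep X \<delta>"
      \<comment> \<open>Only balls that meet the ball of full mass count. As
        \<open>1 \<le> \<delta>\<close>, their centres lie within a fixed multiple of
        \<open>\<delta>\<close> from the origin, so packing bounds their number independently of
        \<open>\<delta>\<close>.\<close>
      let ?Y = "{x \<in> X. measure \<nu> (cball x (?d * \<delta>)) \<noteq> 0}"
      have "?Y \<subseteq> cball 0 ((R\<^sub>\<nu> + ?d) * \<delta>)"
      proof
        fix x assume "x \<in> ?Y"
        then have "cball x (?d * \<delta>) \<inter> cball 0 R\<^sub>\<nu> \<noteq> {}"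
          using nu.prob_null[of "cball x (?d * \<delta>)"] by auto
        then obtain y where "dist x y \<le> ?d * \<delta>" "norm y \<le> R\<^sub>\<nu>"
          by auto
        moreover have "R\<^sub>\<nu> \<le> R\<^sub>\<nu> * \<delta>"
          using base nu.R_nonneg by (simp add: mult_le_cancel_left1)
        ultimately show "x \<in> cball 0 ((R\<^sub>\<nu> + ?d) * \<delta>)"
          using norm_triangle_sub[of x y] by (simp add: dist_norm algebra_simps)
      qed
      then have "card ?Y \<le> M"
        using M[of \<delta> ?Y 0] X base by auto
      have "(\<Sum>x\<in>X. measure \<nu> (cball x (?d * \<delta>)) powr q) = (\<Sum>x\<in>?Y. measure \<nu> (cball x (?d * \<delta>)) powr q)"
        using X by (intro sum.mono_neutral_right) auto
      also have "\<dots> \<le> (\<Sum>x\<in>?Y. 1)"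
        using q by (intro sum_mono powr_le1) auto
      also have "\<dots> \<le> real M"
        using \<open>card ?Y \<le> M\<close> by simp
      also have "\<dots> = real M * cmin powr - s * (1 / cmin) powr - s"
        using cmin_cmax by (simp add: powr_divide)
      also have "\<dots> \<le> A * \<delta> powr - s"
        using A A0 base s by (intro mult_mono powr_mono2') auto
      finally show "(\<Sum>x\<in>X. measure \<nu> (cball x (?d * \<delta>)) powr q) \<le> A * \<delta> powr - s" .
    qed
  next
    case (step \<delta>)
    show ?case
    proof (intro allI impI)
      fix X :: "'a set" assume X: "?sep X \<delta>"
      let ?m = "\<lambda>i x. measure \<nu> (cball (inv (f i) x) (?d * \<delta> / c i))"
      have part: "(\<Sum>x\<in>X. ?m i x powr q) \<le> A * \<delta> powr - s * c i powr s" if i: "i \<in> {1..N}" for i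
      proof -
        have inj: "inj_on (inv (f i)) X"
          using bij_imp_bij_inv[OF similitude_bij[OF sim[OF i]]] by (meson bij_is_inj inj_on_subset subset_UNIV)
        \<comment> \<open>The inverse of \<open>f i\<close> stretches distances by
          \<open>1 / c i\<close>, so the image of \<open>X\<close> is admissible at scale
          \<open>\<delta> / c i\<close>; for this the bound is asserted for all separated
          sets.\<close>
        have "?sep (inv (f i) ` X) (\<delta> / c i)"
          using X c_pos[OF i] by (auto simp: similitude_inv_dist[OF sim[OF i]] intro!: divide_right_mono)
        then have "(\<Sum>y\<in>inv (f i) ` X. measure \<nu> (cball y (?d * (\<delta> / c i))) powr q) \<le> A * (\<delta> / c i) powr - s"
          using step.IH[OF i] by blast
        then show ?thesis
          using c_pos[OF i] step.hyps by (simp add: sum.reindex[OF inj] powr_divide powr_minus field_simps)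
      qed
      have "(\<Sum>x\<in>X. measure \<nu> (cball x (?d * \<delta>)) powr q) \<le>
          (\<Sum>x\<in>X. measure \<mu> (cball x (?d * \<delta>)) powr q + (\<Sum>i=1..N. p i powr q * ?m i x powr q))"
      proof (rule sum_mono)
        fix x
        \<comment> \<open>Index 0 carries the condensation term, so that subadditivity is applied
          once to all \<open>N + 1\<close> terms.\<close>
        let ?a = "\<lambda>i. if i = 0 then p 0 * measure \<mu> (cball x (?d * \<delta>)) else p i * ?m i x"
        have split: "sum g {0..N} = g 0 + sum g {1..N}" for g :: "nat \<Rightarrow> real"
          by (simp add: sum.atLeast_Suc_atMost)
        have "measure \<nu> (cball x (?d * \<delta>)) = sum ?a {0..N}"
          unfolding split by (subst nu_cball) simp
        also have "\<dots> powr q \<le> (\<Sum>i=0..N. ?a i powr q)"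
          using p_pos q by (intro sum_powr_subadditive) (auto simp: less_imp_le)
        also have "\<dots> = p 0 powr q * measure \<mu> (cball x (?d * \<delta>)) powr q + (\<Sum>i=1..N. p i powr q * ?m i x powr q)"
          unfolding split using p_pos by (simp add: powr_mult less_imp_le)
        also have "p 0 powr q * measure \<mu> (cball x (?d * \<delta>)) powr q \<le> 1 * measure \<mu> (cball x (?d * \<delta>)) powr q"
          using p_pos[of 0] q by (intro mult_right_mono powr_le1) auto
        finally show "measure \<nu> (cball x (?d * \<delta>)) powr q \<le>
            measure \<mu> (cball x (?d * \<delta>)) powr q + (\<Sum>i=1..N. p i powr q * ?m i x powr q)"
          by simp
      qed
      also have "\<dots> = (\<Sum>x\<in>X. measure \<mu> (cball x (?d * \<delta>)) powr q) + (\<Sum>i=1..N. p i powr q * (\<Sum>x\<in>X. ?m i x powr q))"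
        by (simp only: sum.distrib sum_distrib_left sum.swap[of _ X "{1..N}"])
      also have "\<dots> \<le> K1 * \<delta> powr - s + (\<Sum>i=1..N. p i powr q * (A * \<delta> powr - s * c i powr s))"
        using X step.hyps by (intro add_mono K1(2) sum_mono mult_left_mono part) auto
      also have "\<dots> = (K1 + A * pressure N p c q s) * \<delta> powr - s"
        by (simp add: pressure_def sum_distrib_left sum_distrib_right algebra_simps)
      also have "\<dots> \<le> A * \<delta> powr - s"
        using A by (intro mult_right_mono) (auto simp: algebra_simps)
      finally show "(\<Sum>x\<in>X. measure \<nu> (cball x (?d * \<delta>)) powr q) \<le> A * \<delta> powr - s" .
    qed
  qed
  have "lq_sum \<nu> q n \<le> A * (2 ^ n) powr s" for n
  proof -
    have "1 / 2 ^ n \<le> (1::real)"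
      by simp
    also have "\<dots> \<le> 1 / cmin"
      using cmin_cmax by simp
    finally have small: "1 / 2 ^ n \<le> 1 / cmin" .
    have "lq_sum \<nu> q n \<le> (\<Sum>z\<in>charged \<nu> n. measure \<nu> (cball z (?d * (1 / 2 ^ n))) powr q)"
      using nu.lq_sum_le_ball_sum[of q n] q by simp
    also have "\<dots> \<le> A * (1 / 2 ^ n) powr - s"
      using bound[OF _ small] nu.charged_separated[of _ n] by auto
    also have "\<dots> = A * (2 ^ n) powr s"
      by (simp add: powr_divide powr_minus)
    finally show ?thesis .
  qed
  then show ?thesis
    using that A0 by blast
qed

text \<open>Iterating the balls around a point of \<open>U\<close> keeps them disjoint by the open set condition;
  the mass is collected from larger concentric balls, because \<open>U\<close> itself may be a null set.\<close>

lemma lq_sum_nu_lower: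
  assumes q: "0 < q" "q \<le> 1" and s: "0 \<le> s" and expanding: "1 \<le> pressure N p c q s"
    and U: "open U" "U \<noteq> {}" "\<And>i. i \<in> {1..N} \<Longrightarrow> f i ` U \<subseteq> U"
      "\<And>i j. \<lbrakk>i \<in> {1..N}; j \<in> {1..N}; i \<noteq> j\<rbrakk> \<Longrightarrow> f i ` U \<inter> f j ` U = {}"
  obtains K where "0 < K" "\<And>n. K * (2 ^ n) powr s \<le> lq_sum \<nu> q n"
proof -
  obtain u e where u: "u \<in> U" "0 < e" "cball u e \<subseteq> U"
    using U(1,2) by (meson open_contains_cball ex_in_conv)
  \<comment> \<open>\<open>a\<close> is small enough that the starting ball stays inside
    \<open>U\<close> at all scales up to \<open>1 / cmin\<close>; \<open>b\<close> is large enough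
    that the ball of radius \<open>b\<close> around \<open>u\<close> has full mass.\<close>
  define a where "a = e * cmin"
  define b where "b = norm u + R\<^sub>\<nu>"
  have a: "0 < a"
    using u cmin_cmax by (simp add: a_def)
  have b: "0 \<le> b"
    using nu.R_nonneg by (simp add: b_def)
  let ?m = "\<lambda>x \<delta>. measure \<nu> (cball x (b * \<delta>)) powr q"
  let ?ok = "\<lambda>X \<delta>. finite X \<and> (\<forall>x\<in>X. cball x (a * \<delta>) \<subseteq> U) \<and>
    (\<forall>x\<in>X. \<forall>y\<in>X. x \<noteq> y \<longrightarrow> cball x (a * \<delta>) \<inter> cball y (a * \<delta>) = {})"
  have packed: "\<exists>X. ?ok X \<delta> \<and> \<delta> powr - s \<le> (\<Sum>x\<in>X. ?m x \<delta>)"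
    if "0 < \<delta>" "\<delta> \<le> 1 / cmin" for \<delta>
    using that
  proof (induction \<delta> rule: renewal_scale_induct)
    case (base \<delta>)
    have "a * \<delta> \<le> e"
      using base mult_left_mono[of \<delta> "1 / cmin" a] a cmin_cmax by (simp add: a_def)
    then have "?ok {u} \<delta>"
      using u by (auto intro: order_trans)
    have "cball 0 R\<^sub>\<nu> \<subseteq> cball u (b * 1)"
      by (auto simp: b_def dist_norm intro!: order_trans[OF norm_triangle_ineq4])
    also have "\<dots> \<subseteq> cball u (b * \<delta>)"
      using base b by (intro subset_cball mult_left_mono) auto
    finally have "measure \<nu> (cball 0 R\<^sub>\<nu>) \<le> measure \<nu> (cball u (b * \<delta>))"
      by (intro nu.finite_measure_mono) auto
    then have "measure \<nu> (cball u (b * \<delta>)) = 1"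
      using nu.conc nu.prob_le_1[of "cball u (b * \<delta>)"] by simp
    moreover have "\<delta> powr - s \<le> 1"
      using base s powr_mono2'[of "- s" 1 \<delta>] by simp
    ultimately show ?case
      using \<open>?ok {u} \<delta>\<close> by (intro exI[of _ "{u}"]) simp
  next
    case (step \<delta>)
    from step.IH obtain X where X: "\<And>i. i \<in> {1..N} \<Longrightarrow> ?ok (X i) (\<delta> / c i)"
      "\<And>i. i \<in> {1..N} \<Longrightarrow> (\<delta> / c i) powr - s \<le> (\<Sum>x\<in>X i. ?m x (\<delta> / c i))"
      by metis
    let ?Y = "\<Union>i\<in>{1..N}. f i ` X i"
    have inj: "inj (f i)" and surj: "surj (f i)" if "i \<in> {1..N}" for i
      using similitude_bij[OF sim[OF that]] by (auto simp: bij_def)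
    have img: "cball (f i x) (a * \<delta>) = f i ` cball x (a * (\<delta> / c i))" if i: "i \<in> {1..N}" for i x
    proof -
      have "f i -` cball (f i x) (a * \<delta>) = cball x (a * (\<delta> / c i))"
        using similitude_vimage_cball[OF sim[OF i], of "f i x" "a * \<delta>"] inv_f_f[OF inj[OF i]] by simp
      then show ?thesis
        using surj[OF i] by (metis surj_image_vimage_eq)
    qed
    have XU: "X i \<subseteq> U" if i: "i \<in> {1..N}" for i
    proof
      fix x assume "x \<in> X i"
      moreover have "x \<in> cball x (a * (\<delta> / c i))"
        using a step.hyps c_pos[OF i] by simp
      ultimately show "x \<in> U"
        using X(1)[OF i] by blast
    qed
    have "?ok ?Y \<delta>"
    proof (intro conjI ballI impI)
      show "finite ?Y"
        using X by auto
      fix y assume "y \<in> ?Y"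
      then obtain i x where ix: "i \<in> {1..N}" "x \<in> X i" "y = f i x"
        by auto
      have yU: "cball y (a * \<delta>) \<subseteq> f i ` U"
        using X(1)[OF ix(1)] ix(2) unfolding ix(3) img[OF ix(1)] by blast
      then show "cball y (a * \<delta>) \<subseteq> U"
        using U(3)[OF ix(1)] by blast
      fix z assume "z \<in> ?Y" "y \<noteq> z"
      then obtain j w where jw: "j \<in> {1..N}" "w \<in> X j" "z = f j w"
        by auto
      have zU: "cball z (a * \<delta>) \<subseteq> f j ` U"
        using X(1)[OF jw(1)] jw(2) unfolding jw(3) img[OF jw(1)] by blast
      show "cball y (a * \<delta>) \<inter> cball z (a * \<delta>) = {}"
      \<comment> \<open>For different maps the balls lie in disjoint images of \<open>U\<close>; for
        the same map disjointness is inherited from scale \<open>\<delta> / c i\<close> by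
        injectivity.\<close>
      proof (cases "i = j")
        case False
        then show ?thesis
          using U(4)[OF ix(1) jw(1)] yU zU by blast
      next
        case True
        have "x \<noteq> w"
          using ix jw True \<open>y \<noteq> z\<close> by auto
        then have "cball x (a * (\<delta> / c i)) \<inter> cball w (a * (\<delta> / c i)) = {}"
          using X(1)[OF ix(1)] ix(2) jw(2) True by blast
        then show ?thesis
          using ix jw True img[OF ix(1)] image_Int[OF inj[OF ix(1)]] by (metis image_empty)
      qed
    qed
    moreover have "\<delta> powr - s \<le> (\<Sum>y\<in>?Y. ?m y \<delta>)"
    proof -
      \<comment> \<open>Since
        \<open>c i powr s * \<delta> powr - s = (\<delta> / c i) powr - s\<close>, pressure at least
        1 turns the bounds at the scales \<open>\<delta> / c i\<close> into one at
        \<open>\<delta>\<close>.\<close>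
      have "1 * \<delta> powr - s \<le> pressure N p c q s * \<delta> powr - s"
        using expanding by (intro mult_right_mono) auto
      also have "\<dots> = (\<Sum>i=1..N. p i powr q * (\<delta> / c i) powr - s)"
        using step.hyps c_pos unfolding pressure_def sum_distrib_right
        by (intro sum.cong refl) (simp add: powr_divide powr_minus divide_simps less_imp_le)
      also have "\<dots> \<le> (\<Sum>i=1..N. p i powr q * (\<Sum>x\<in>X i. ?m x (\<delta> / c i)))"
        using X(2) by (intro sum_mono mult_left_mono) auto
      also have "\<dots> \<le> (\<Sum>i=1..N. \<Sum>y\<in>f i ` X i. ?m y \<delta>)"
      proof (rule sum_mono)
        fix i assume i: "i \<in> {1..N}"
        have "p i powr q * (\<Sum>x\<in>X i. ?m x (\<delta> / c i)) = (\<Sum>x\<in>X i. (p i * measure \<nu> (cball x (b * (\<delta> / c i)))) powr q)"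
          using p_pos[of i] i by (simp add: sum_distrib_left powr_mult)
        also have "\<dots> \<le> (\<Sum>x\<in>X i. ?m (f i x) \<delta>)"
        proof (intro sum_mono powr_mono2)
          fix x
          let ?g = "\<lambda>j. p j * measure \<nu> (cball (inv (f j) (f i x)) (b * \<delta> / c j))"
          \<comment> \<open>Only the \<open>i\<close>-th term of the self-similarity equation is
            kept.\<close>
          have "?g i \<le> sum ?g {1..N}"
            using i p_pos by (intro member_le_sum) (auto simp: less_imp_le)
          also have "\<dots> \<le> measure \<nu> (cball (f i x) (b * \<delta>))"
            using p_pos[of 0] by (subst nu_cball) simp
          finally show "p i * measure \<nu> (cball x (b * (\<delta> / c i))) \<le> measure \<nu> (cball (f i x) (b * \<delta>))"
            using inv_f_f[OF inj[OF i]] by simp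
        qed (use q p_pos[of i] i in auto)
        also have "\<dots> = (\<Sum>y\<in>f i ` X i. ?m y \<delta>)"
          by (rule sum.reindex_cong[symmetric, OF inj_on_subset[OF inj[OF i]]]) auto
        finally show "p i powr q * (\<Sum>x\<in>X i. ?m x (\<delta> / c i)) \<le> (\<Sum>y\<in>f i ` X i. ?m y \<delta>)" .
      qed
      also have "\<dots> = (\<Sum>y\<in>?Y. ?m y \<delta>)"
      proof (rule sum.UNION_disjoint[symmetric])
        show "\<forall>i\<in>{1..N}. finite (f i ` X i)"
          using X by auto
        show "\<forall>i\<in>{1..N}. \<forall>j\<in>{1..N}. i \<noteq> j \<longrightarrow> f i ` X i \<inter> f j ` X j = {}"
          using U(4) XU by blast
      qed simp
      finally show ?thesis
        by simp
    qed
    ultimately have "?ok ?Y \<delta> \<and> \<delta> powr - s \<le> (\<Sum>y\<in>?Y. ?m y \<delta>)"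
      by (rule conjI)
    then show ?case
      by (rule exI)
  qed
  obtain K where K: "0 < K" "\<And>n X. \<lbrakk>finite X; \<And>x y. \<lbrakk>x \<in> X; y \<in> X; x \<noteq> y\<rbrakk> \<Longrightarrow> a / 2 ^ n \<le> dist x y\<rbrakk>
      \<Longrightarrow> (\<Sum>x\<in>X. measure \<nu> (cball x (b / 2 ^ n)) powr q) \<le> K * lq_sum \<nu> q n"
    using nu.ball_sum_le_lq_sum[OF a q] by metis
  have "1 / K * (2 ^ n) powr s \<le> lq_sum \<nu> q n" for n
  proof -
    have "1 / 2 ^ n \<le> (1::real)"
      by simp
    also have "\<dots> \<le> 1 / cmin"
      using cmin_cmax by simp
    finally have "1 / 2 ^ n \<le> 1 / cmin" .
    then obtain X where X: "?ok X (1 / 2 ^ n)" "(1 / 2 ^ n) powr - s \<le> (\<Sum>x\<in>X. ?m x (1 / 2 ^ n))"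
      using packed[of "1 / 2 ^ n"] by auto
    have "a / 2 ^ n \<le> dist x y" if "x \<in> X" "y \<in> X" "x \<noteq> y" for x y
    proof (rule ccontr)
      assume "\<not> a / 2 ^ n \<le> dist x y"
      then have "y \<in> cball x (a * (1 / 2 ^ n)) \<inter> cball y (a * (1 / 2 ^ n))"
        using a by simp
      then show False
        using X(1) that by blast
    qed
    then have "(\<Sum>x\<in>X. ?m x (1 / 2 ^ n)) \<le> K * lq_sum \<nu> q n"
      using K(2)[of X n] X(1) by simp
    then have "(2 ^ n) powr s \<le> K * lq_sum \<nu> q n"
      using X(2) by (simp add: powr_divide powr_minus)
    then show ?thesis
      using K(1) by (simp add: divide_le_eq mult.commute)
  qed
  then show ?thesis
    using K(1) by (intro that[of "1 / K"]) auto
qed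

end

lemma (in bounded_borel_prob) lq_spectrum_eqI:
  "lq_approx \<eta> q \<longlonglongrightarrow> \<beta> \<Longrightarrow> lq_spectrum \<eta> q = ereal \<beta>"
  unfolding lq_spectrum_def by (intro lim_imp_Limsup) auto

section \<open>The root of the pressure and the limit spectrum\<close>

context inhom_ifs
begin

lemma pressure_strict_antimono:
  assumes "s < t"
  shows "pressure N p c q t < pressure N p c q s"
  unfolding pressure_def
proof (rule sum_strict_mono)
  fix i assume i: "i \<in> {1..N}"
  have "c i powr t < c i powr s"
    using c_pos[OF i] c_less_1[OF i] assms by (intro powr_less_mono') auto
  then show "p i powr q * c i powr t < p i powr q * c i powr s"
    using p_pos[of i] i by (intro mult_strict_left_mono) auto
qed (use N_pos in auto)

text \<open>Intermediate value theorem: at \<open>a\<close> the first summand alone equals 1, and at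
  a large integer all summands are so small that their sum is at most 1.\<close>

lemma pressure_root: "\<exists>s. pressure N p c q s = 1"
proof -
  have 1: "1 \<in> {1..N}"
    using N_pos by simp
  define a where "a = - q * ln (p 1) / ln (c 1)"
  have "p 1 powr q * c 1 powr a = exp (q * ln (p 1) + a * ln (c 1))"
    using p_pos[of 1] c_pos[OF 1] 1 by (simp add: powr_def exp_add)
  also have "q * ln (p 1) + a * ln (c 1) = 0"
    using c_pos[OF 1] c_less_1[OF 1] by (simp add: a_def)
  finally have "1 = p 1 powr q * c 1 powr a"
    by simp
  also have "\<dots> \<le> pressure N p c q a"
    unfolding pressure_def using 1 by (intro member_le_sum[of 1 "{1..N}" "\<lambda>k. p k powr q * c k powr a"]) auto
  finally have a: "1 \<le> pressure N p c q a" .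
  define W where "W = (\<Sum>k=1..N. p k powr q) + 1"
  have W: "0 < W"
    by (simp add: W_def add_nonneg_pos sum_nonneg)
  obtain n where n: "cmax ^ n < 1 / W"
    using real_arch_pow_inv[of "1 / W" cmax] cmin_cmax W by auto
  have "pressure N p c q (real n) \<le> (\<Sum>k=1..N. p k powr q * cmax ^ n)"
    unfolding pressure_def
  proof (intro sum_mono mult_left_mono)
    fix i assume i: "i \<in> {1..N}"
    show "c i powr real n \<le> cmax ^ n"
      using c_pos[OF i] cmax_ge[OF i] by (simp add: powr_realpow power_mono)
  qed auto
  also have "\<dots> \<le> W * cmax ^ n"
    using cmin_cmax by (simp add: W_def sum_distrib_right[symmetric] distrib_right)
  also have "\<dots> \<le> 1"
    using n W by (simp add: field_simps)
  finally have b: "pressure N p c q (real n) \<le> 1" .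
  have "a \<le> real n"
    using a b pressure_strict_antimono[of "real n" a q] by linarith
  then have "\<exists>x\<ge>a. x \<le> real n \<and> pressure N p c q x = 1"
    using c_pos unfolding pressure_def
    by (intro IVT2' continuous_intros) (use a b in \<open>force simp: pressure_def\<close>)+
  then show ?thesis
    by blast
qed

lemma pressure_rho: "pressure N p c q (rho N p c q) = 1"
proof -
  have "\<exists>!s. pressure N p c q s = 1"
    using pressure_root pressure_strict_antimono by (metis linorder_neqE_linordered_idom less_irrefl)
  then show ?thesis
    unfolding rho_def pressure_def[symmetric] by (rule theI')
qed

text \<open>The self-similarity equation makes \<open>\<nu>\<close> at least \<open>p 0\<close>
  times \<open>\<mu>\<close> on every cell.\<close>

lemma lq_sum_mu_le:
  assumes "0 \<le> q"
  shows "p 0 powr q * lq_sum \<mu> q n \<le> lq_sum \<nu> q n"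
proof -
  have cell: "p 0 * measure \<mu> (cell n z) \<le> measure \<nu> (cell n z)" for z
  proof -
    have "0 \<le> (\<Sum>i=1..N. p i * measure (distr \<nu> borel (f i)) (cell n z))"
      using p_pos by (intro sum_nonneg mult_nonneg_nonneg) (auto simp: less_imp_le)
    then show ?thesis
      by (subst self_similar) (auto simp: cell_borel)
  qed
  have sub: "charged \<mu> n \<subseteq> charged \<nu> n"
  proof
    fix z assume z: "z \<in> charged \<mu> n"
    then have "0 < p 0 * measure \<mu> (cell n z)"
      using p_pos[of 0] by (simp add: charged_def)
    then show "z \<in> charged \<nu> n"
      using z cell[of z] by (simp add: charged_def)
  qed
  have "p 0 powr q * lq_sum \<mu> q n = (\<Sum>z\<in>charged \<mu> n. (p 0 * measure \<mu> (cell n z)) powr q)"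
    using p_pos[of 0] by (simp add: lq_sum_def sum_distrib_left powr_mult)
  also have "\<dots> \<le> (\<Sum>z\<in>charged \<mu> n. measure \<nu> (cell n z) powr q)"
    using p_pos[of 0] cell assms by (intro sum_mono powr_mono2) auto
  also have "\<dots> \<le> lq_sum \<nu> q n"
    unfolding lq_sum_def by (intro sum_mono2 sub) auto
  finally show ?thesis .
qed

text \<open>Above the maximum the pressure is below 1 and the renewal bound applies. Below it,
  either the condensation measure alone grows fast enough, or the packing supplied by the open set
  condition does.\<close>

lemma lq_approx_nu_tendsto:
  assumes q: "0 < q" "q < 1" and \<beta>: "lq_approx \<mu> q \<longlonglongrightarrow> \<beta>"
    and U: "open U" "U \<noteq> {}" "\<And>i. i \<in> {1..N} \<Longrightarrow> f i ` U \<subseteq> U"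
      "\<And>i j. \<lbrakk>i \<in> {1..N}; j \<in> {1..N}; i \<noteq> j\<rbrakk> \<Longrightarrow> f i ` U \<inter> f j ` U = {}"
  shows "lq_approx \<nu> q \<longlonglongrightarrow> max \<beta> (rho N p c q)"
  unfolding nu.lq_approx_eq
proof (rule growth_rate_tendsto)
  fix s assume s: "max \<beta> (rho N p c q) < s"
  obtain K where "\<And>n. lq_sum \<mu> q n \<le> K * (2 ^ n) powr s"
    using mu.lq_sum_upper[OF \<beta>, of s] q s by auto
  moreover have "pressure N p c q s < 1"
    using pressure_strict_antimono[of "rho N p c q" s q] s by (simp add: pressure_rho)
  ultimately obtain K' where "0 < K'" "\<And>n. lq_sum \<nu> q n \<le> K' * (2 ^ n) powr s"
    using lq_sum_nu_upper[of q s K] q s mu.lq_approx_limit_bounds(1)[OF \<beta>] by auto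
  then show "\<exists>K>0. \<forall>n. lq_sum \<nu> q n \<le> K * (2 ^ n) powr s"
    by blast
next
  fix s assume s: "s < max \<beta> (rho N p c q)"
  show "\<exists>K>0. \<forall>n. K * (2 ^ n) powr s \<le> lq_sum \<nu> q n"
  proof (cases "s < \<beta>")
    case True
    obtain K where K: "0 < K" "\<And>n. K * (2 ^ n) powr s \<le> lq_sum \<mu> q n"
      using mu.lq_sum_lower[OF \<beta> _ True] q by auto
    have "p 0 powr q * K * (2 ^ n) powr s \<le> lq_sum \<nu> q n" for n
      using mult_left_mono[OF K(2)[of n], of "p 0 powr q"] lq_sum_mu_le[of q n] q by simp
    then show ?thesis
      using K(1) p_pos[of 0] by (intro exI[of _ "p 0 powr q * K"]) auto
  next
    \<comment> \<open>Now \<open>\<beta> \<le> s < rho N p c q\<close>; since \<open>\<beta>\<close>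
      is nonnegative, so is \<open>s\<close>, as the packing bound requires.\<close>
    case False
    then have "1 \<le> pressure N p c q s" "0 \<le> s"
      using pressure_strict_antimono[of s "rho N p c q" q] s q mu.lq_approx_limit_bounds(1)[OF \<beta>]
      by (auto simp: pressure_rho less_max_iff_disj)
    then obtain K where "0 < K" "\<And>n. K * (2 ^ n) powr s \<le> lq_sum \<nu> q n"
      using lq_sum_nu_lower[of q s U] q U by (metis less_imp_le)
    then show ?thesis
      by blast
  qed
qed

end

subsection \<open>Quantization error\<close>

context bounded_borel_prob
begin

lemma integrable_infdist_powr:
  assumes "\<alpha> \<noteq> {}" "0 < r"
  shows "integrable \<eta> (\<lambda>x. infdist x \<alpha> powr r)"
proof -
  obtain a where a: "a \<in> \<alpha>"
    using assms by auto
  have [measurable]: "(\<lambda>x. infdist x \<alpha>) \<in> borel_measurable borel"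
    by (intro borel_measurable_continuous_onI continuous_intros)
  have "(\<lambda>x. infdist x \<alpha> powr r) \<in> borel_measurable borel"
    by measurable
  then have "(\<lambda>x. infdist x \<alpha> powr r) \<in> borel_measurable \<eta>"
    by (simp add: measurable_cong_sets[OF sets_eq refl])
  moreover have "AE x in \<eta>. norm (infdist x \<alpha> powr r) \<le> (R + norm a) powr r"
    using AE_cball
  proof eventually_elim
    case (elim x)
    have "infdist x \<alpha> \<le> dist x a"
      using a by (rule infdist_le)
    also have "\<dots> \<le> R + norm a"
      using elim norm_triangle_ineq4[of x a] by (simp add: dist_norm)
    finally show ?case
      using assms by (simp add: powr_mono2 infdist_nonneg)
  qed
  ultimately show ?thesis
    by (intro integrable_const_bound) auto
qed

lemma quantization_error_le:
  assumes "1 \<le> card \<alpha>" "card \<alpha> \<le> n"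
  shows "quantization_error \<eta> r n \<le> (LINT x|\<eta>. infdist x \<alpha> powr r) powr (1 / r)"
  unfolding quantization_error_def
  by (rule cInf_lower) (use assms in \<open>auto intro!: bdd_belowI[of _ 0]\<close>)

lemma quantization_error_ge:
  assumes "1 \<le> n" "0 \<le> L" "0 < r"
    and "\<And>\<alpha>. \<lbrakk>finite \<alpha>; \<alpha> \<noteq> {}; card \<alpha> \<le> n\<rbrakk> \<Longrightarrow> L \<le> (LINT x|\<eta>. infdist x \<alpha> powr r)"
  shows "L powr (1 / r) \<le> quantization_error \<eta> r n"
  unfolding quantization_error_def
proof (rule cInf_greatest)
  have "1 \<le> card {0::'a} \<and> card {0::'a} \<le> n"
    using assms by simp
  then show "{(LINT x|\<eta>. infdist x \<alpha> powr r) powr (1 / r) |\<alpha>. 1 \<le> card \<alpha> \<and> card \<alpha> \<le> n} \<noteq> {}"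
    by blast
  fix e assume "e \<in> {(LINT x|\<eta>. infdist x \<alpha> powr r) powr (1 / r) |\<alpha>. 1 \<le> card \<alpha> \<and> card \<alpha> \<le> n}"
  then obtain \<alpha> where \<alpha>: "e = (LINT x|\<eta>. infdist x \<alpha> powr r) powr (1 / r)" "1 \<le> card \<alpha>" "card \<alpha> \<le> n"
    by auto
  have "finite \<alpha>" "\<alpha> \<noteq> {}"
    using \<alpha>(2) card_ge_0_finite[of \<alpha>] by auto
  then have "L \<le> (LINT x|\<eta>. infdist x \<alpha> powr r)"
    using assms(4) \<alpha>(3) by blast
  then show "L powr (1 / r) \<le> e"
    unfolding \<alpha>(1) using assms by (intro powr_mono2) auto
qed

text \<open>Level \<open>n\<close> contributes at most \<open>K * x ^ n\<close> with
  \<open>x = 2 powr (s - r * q) < 1\<close>, so a geometric series dominates the sum over all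
  levels.\<close>

lemma weighted_lq_sum_bound:
  assumes q: "0 < q" "q \<le> 1" and K: "\<And>n. lq_sum \<eta> q n \<le> K * (2 ^ n) powr s" and s: "s < r * q"
  obtains C where "0 < C" "\<And>L. (\<Sum>n<L. \<Sum>z\<in>charged \<eta> n. (prob (cell n z) * (2 ^ n) powr - r) powr q) \<le> C"
proof -
  have K0: "0 < K"
    using K[of 0] lq_sum_pos[OF q(2), of 0] by simp
  define x :: real where "x = 2 powr (s - r * q)"
  have x: "0 < x" "x < 1"
    using s powr_less_mono[of "s - r * q" 0 2] by (auto simp: x_def)
  have "(\<Sum>n<L. \<Sum>z\<in>charged \<eta> n. (prob (cell n z) * (2 ^ n) powr - r) powr q) \<le> K / (1 - x)" for L
  proof -
    have "(\<Sum>n<L. \<Sum>z\<in>charged \<eta> n. (prob (cell n z) * (2 ^ n) powr - r) powr q) \<le> (\<Sum>n<L. K * x ^ n)"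
    proof (rule sum_mono)
      fix n
      have "(\<Sum>z\<in>charged \<eta> n. (prob (cell n z) * (2 ^ n) powr - r) powr q) = lq_sum \<eta> q n * (2 ^ n) powr - (r * q)"
        by (simp add: lq_sum_def sum_distrib_right powr_mult powr_powr)
      also have "\<dots> \<le> K * (2 ^ n) powr s * (2 ^ n) powr - (r * q)"
        by (intro mult_right_mono K) simp
      also have "\<dots> = K * (2 ^ n) powr (s - r * q)"
        by (simp add: powr_diff powr_minus_divide)
      also have "(2 ^ n) powr (s - r * q) = x ^ n"
        by (simp add: x_def powr_def ln_realpow exp_of_nat_mult[symmetric] mult_ac)
      finally show "(\<Sum>z\<in>charged \<eta> n. (prob (cell n z) * (2 ^ n) powr - r) powr q) \<le> K * x ^ n" .
    qed
    also have "\<dots> = K * (\<Sum>n<L. x ^ n)"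
      by (simp add: sum_distrib_left)
    also have "(\<Sum>n<L. x ^ n) = (1 - x ^ L) / (1 - x)"
      using x by (simp add: sum_gp_strict)
    also have "K * \<dots> \<le> K * (1 / (1 - x))"
      using x K0 by (intro mult_left_mono divide_right_mono) auto
    finally show ?thesis
      by simp
  qed
  then show ?thesis
    using K0 x by (intro that[of "K / (1 - x)"]) auto
qed

text \<open>Greedy upper bound: take the grid points of all dyadic cells \<open>C\<close> of side \<open>2\<^sup>-\<^sup>n\<close> with
  \<open>\<eta> C * 2\<^sup>-\<^sup>n\<^sup>r \<ge> t\<close>.\<close>

lemma quantization_error_upper:
  assumes r: "0 < r" and q: "0 < q" "q < 1"
    and K: "\<And>n. lq_sum \<eta> q n \<le> K * (2 ^ n) powr s" and s: "s < r * q"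
  obtains C where "0 < C"
    "\<And>n. 2 \<le> n \<Longrightarrow> quantization_error \<eta> r n \<le> (C * real n powr - ((1 - q) / q)) powr (1 / r)"
proof -
  \<comment> \<open>Up to a constant, \<open>w n z\<close> is the contribution of a cell to the
    \<open>r\<close>-th power error when a point at a distance of the order of its side serves
    it.\<close>
  define w where "w = (\<lambda>n z. prob (cell n z) * (2 ^ n) powr - r)"
  obtain C1 where C1: "0 < C1" "\<And>L. (\<Sum>n<L. \<Sum>z\<in>charged \<eta> n. w n z powr q) \<le> C1"
    using weighted_lq_sum_bound[OF q(1) less_imp_le[OF q(2)] K s] unfolding w_def by blast
  \<comment> \<open>\<open>R\<close> bounds the distance to the origin, used at level 0;
    \<open>2 * real DIM('a)\<close> allows for the corner of the parent cell.\<close>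
  define D where "D = R + 2 * real DIM('a)"
  have D: "0 < D"
    using R_nonneg by (simp add: D_def add_nonneg_pos)
  have w_pos: "0 < w n z" if "z \<in> charged \<eta> n" for n z
    using that by (simp add: w_def charged_def)
  have main: "\<exists>\<alpha>. finite \<alpha> \<and> \<alpha> \<noteq> {} \<and> real (card \<alpha>) \<le> 1 + C1 * t powr - q \<and>
      (LINT x|\<eta>. infdist x \<alpha> powr r) \<le> D powr r * C1 * t powr (1 - q)" if t: "0 < t" for t
  proof -
    \<comment> \<open>At level \<open>L\<close> even mass 1 has weight below \<open>t\<close>, so no
      cell is bad there and refinement stops at \<open>L\<close> at the latest.\<close>
    obtain L where "(2 powr - r) ^ L < t"
      using real_arch_pow_inv[OF t, of "2 powr - r"] r powr_less_mono[of "- r" 0 2] by auto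
    moreover have "(2 powr - r) ^ L = (2 ^ L) powr - r"
      by (simp add: powr_realpow[symmetric] powr_powr mult.commute)
    ultimately have L: "(2 ^ L) powr - r < t"
      by simp
    define bad where "bad = (\<lambda>n. {z \<in> charged \<eta> n. t \<le> w n z})"
    have fin_bad: "finite (bad n)" for n
      by (simp add: bad_def)
    have "w L z < t" for z
    proof -
      have "w L z \<le> 1 * (2 ^ L) powr - r"
        unfolding w_def by (intro mult_right_mono) auto
      with L show ?thesis
        by simp
    qed
    then have bad_L: "bad L = {}"
      by (auto simp: bad_def dest: leD)
    \<comment> \<open>The origin keeps \<open>\<alpha>\<close> nonempty and serves the points whose
      cell of level 0 is not bad.\<close>
    define \<alpha> where "\<alpha> = insert 0 (\<Union>n<L. bad n)"
    have fin: "finite \<alpha>" "\<alpha> \<noteq> {}"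
      using fin_bad by (auto simp: \<alpha>_def)
    have "card \<alpha> \<le> Suc (card (\<Union>n<L. bad n))"
      unfolding \<alpha>_def by (rule card_insert_le_m1) auto
    also have "\<dots> \<le> Suc (\<Sum>n<L. card (bad n))"
      using card_UN_le[of "{..<L}" bad] by simp
    finally have "real (card \<alpha>) \<le> 1 + (\<Sum>n<L. real (card (bad n)))"
      by (simp add: of_nat_le_iff[where 'a = real, symmetric] del: of_nat_le_iff)
    \<comment> \<open>A Chebyshev estimate: each bad cell contributes at least
      \<open>t powr q\<close> to the moment sum.\<close>
    also have "(\<Sum>n<L. real (card (bad n))) \<le> (\<Sum>n<L. t powr - q * (\<Sum>z\<in>charged \<eta> n. w n z powr q))"
    proof (rule sum_mono)
      fix n
      have "real (card (bad n)) = (\<Sum>z\<in>bad n. t powr - q * t powr q)"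
        using t by (simp add: powr_add[symmetric])
      also have "\<dots> \<le> (\<Sum>z\<in>bad n. t powr - q * w n z powr q)"
        using t q by (intro sum_mono mult_left_mono powr_mono2) (auto simp: bad_def)
      also have "\<dots> \<le> (\<Sum>z\<in>charged \<eta> n. t powr - q * w n z powr q)"
        by (intro sum_mono2) (auto simp: bad_def)
      finally show "real (card (bad n)) \<le> t powr - q * (\<Sum>z\<in>charged \<eta> n. w n z powr q)"
        by (simp add: sum_distrib_left)
    qed
    also have "\<dots> = (\<Sum>n<L. \<Sum>z\<in>charged \<eta> n. w n z powr q) * t powr - q"
      by (simp add: sum_distrib_left sum_distrib_right mult.commute)
    also have "\<dots> \<le> C1 * t powr - q"
      using C1(2) by (intro mult_right_mono) auto
    finally have card: "real (card \<alpha>) \<le> 1 + C1 * t powr - q"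
      by simp
    let ?h = "\<lambda>x. \<Sum>n<Suc L. \<Sum>z\<in>charged \<eta> n - bad n. D powr r * (2 ^ n) powr - r * indicator (cell n z) x"
    have "AE x in \<eta>. \<forall>n. grid_point n x \<in> charged \<eta> n"
      using AE_charged by (simp add: AE_all_countable)
    then have ptw: "AE x in \<eta>. infdist x \<alpha> powr r \<le> ?h x"
      using AE_cball
    proof eventually_elim
      case (elim x)
      \<comment> \<open>The first level at which the cell of \<open>x\<close> is not bad. Its parent
        cell, if \<open>n > 0\<close>, is bad, so the corner of the parent belongs to
        \<open>\<alpha>\<close>.\<close>
      define n where "n = (LEAST n. grid_point n x \<notin> bad n)"
      have n: "grid_point n x \<notin> bad n" "n \<le> L"
        unfolding n_def using bad_L LeastI[of "\<lambda>n. grid_point n x \<notin> bad n" L]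
          Least_le[of "\<lambda>n. grid_point n x \<notin> bad n" L] by auto
      have "infdist x \<alpha> \<le> D / 2 ^ n"
      proof (cases n)
        case 0
        have "infdist x \<alpha> \<le> dist x 0"
          by (rule infdist_le) (simp add: \<alpha>_def)
        then show ?thesis
          using elim(2) 0 by (simp add: D_def)
      next
        case (Suc m)
        then have "grid_point m x \<in> bad m"
          using not_less_Least[of m "\<lambda>n. grid_point n x \<notin> bad n"] by (simp add: n_def)
        then have "infdist x \<alpha> \<le> dist x (grid_point m x)"
          using n(2) Suc by (intro infdist_le) (auto simp: \<alpha>_def)
        also have "\<dots> \<le> 2 * DIM('a) / 2 ^ n"
          using dist_grid_point[of x m] Suc by simp
        also have "\<dots> \<le> D / 2 ^ n"
          using R_nonneg by (intro divide_right_mono) (auto simp: D_def)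
        finally show ?thesis .
      qed
      then have "infdist x \<alpha> powr r \<le> (D / 2 ^ n) powr r"
        using r by (intro powr_mono2) (auto simp: infdist_nonneg)
      also have "\<dots> = D powr r * (2 ^ n) powr - r * indicator (cell n (grid_point n x)) x"
        using D by (simp add: powr_divide powr_minus_divide)
      also have "\<dots> \<le> (\<Sum>z\<in>charged \<eta> n - bad n. D powr r * (2 ^ n) powr - r * indicator (cell n z) x)"
        using elim(1) n(1)
        by (intro member_le_sum[of "grid_point n x" _ "\<lambda>z. D powr r * (2 ^ n) powr - r * indicator (cell n z) x"]) auto
      also have "\<dots> \<le> ?h x"
        using n(2)
        by (intro member_le_sum[of n _ "\<lambda>n. \<Sum>z\<in>charged \<eta> n - bad n. D powr r * (2 ^ n) powr - r * indicator (cell n z) x"])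
           (auto intro!: sum_nonneg)
      finally show ?case .
    qed
    have int: "integrable \<eta> (\<lambda>x. D powr r * (2 ^ n) powr - r * indicator (cell n z) x)" for n z
      by (intro integrable_mult_right integrable_real_indicator) (auto simp: emeasure_eq_measure)
    have "(LINT x|\<eta>. infdist x \<alpha> powr r) \<le> (LINT x|\<eta>. ?h x)"
      by (intro integral_mono_AE integrable_infdist_powr fin r ptw Bochner_Integration.integrable_sum int)
    also have "\<dots> = (\<Sum>n<Suc L. \<Sum>z\<in>charged \<eta> n - bad n.
        LINT x|\<eta>. D powr r * (2 ^ n) powr - r * indicator (cell n z) x)"
      by (simp only: Bochner_Integration.integral_sum Bochner_Integration.integrable_sum int)
    also have "\<dots> = (\<Sum>n<Suc L. \<Sum>z\<in>charged \<eta> n - bad n. D powr r * w n z)"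
      by (simp add: w_def mult_ac)
    also have "\<dots> \<le> (\<Sum>n<Suc L. \<Sum>z\<in>charged \<eta> n. D powr r * (t powr (1 - q) * w n z powr q))"
    proof (intro sum_mono order_trans[OF sum_mono sum_mono2])
      fix n z assume z: "z \<in> charged \<eta> n - bad n"
      \<comment> \<open>Outside the bad cells \<open>w n z < t\<close>, so the factor
        \<open>w n z powr (1 - q)\<close> is at most \<open>t powr (1 - q)\<close>.\<close>
      then have "w n z = w n z powr (1 - q) * w n z powr q"
        using w_pos[of z n] by (simp add: powr_add[symmetric])
      also have "\<dots> \<le> t powr (1 - q) * w n z powr q"
        using z w_pos[of z n] q by (intro mult_right_mono powr_mono2) (auto simp: bad_def)
      finally show "D powr r * w n z \<le> D powr r * (t powr (1 - q) * w n z powr q)"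
        by (rule mult_left_mono) simp
    qed auto
    also have "\<dots> = D powr r * t powr (1 - q) * (\<Sum>n<Suc L. \<Sum>z\<in>charged \<eta> n. w n z powr q)"
      by (simp only: sum_distrib_left mult.assoc)
    also have "\<dots> \<le> D powr r * t powr (1 - q) * C1"
      by (intro mult_left_mono C1(2)) simp
    finally show ?thesis
      using fin card by (intro exI[of _ \<alpha>]) (simp add: mult_ac)
  qed
  define C where "C = D powr r * C1 * (2 * C1) powr ((1 - q) / q)"
  have C: "0 < C"
    using D C1 by (simp add: C_def)
  have "quantization_error \<eta> r n \<le> (C * real n powr - ((1 - q) / q)) powr (1 / r)" if n: "2 \<le> n" for n
  proof -
    \<comment> \<open>Solves \<open>1 + C1 * t powr - q = n\<close>, so that the point set built for
      \<open>t\<close> has at most \<open>n\<close> elements.\<close>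
    define t where "t = (C1 / (real n - 1)) powr (1 / q)"
    have pos: "0 < C1 / (real n - 1)"
      using C1(1) n by simp
    have t: "0 < t"
      unfolding t_def using pos by (simp only: powr_gt_zero)
    have "t powr - q = (C1 / (real n - 1)) powr - 1"
      using q by (simp add: t_def powr_powr)
    also have "\<dots> = (real n - 1) / C1"
      using C1(1) n by (simp add: powr_minus_divide)
    finally have tq: "C1 * t powr - q = real n - 1"
      using C1(1) by simp
    have "t powr (1 - q) = (C1 / (real n - 1)) powr ((1 - q) / q)"
      by (simp add: t_def powr_powr)
    also have "\<dots> \<le> (2 * C1 / real n) powr ((1 - q) / q)"
      using n q C1(1) by (intro powr_mono2) (auto simp: field_simps)
    also have "\<dots> = (2 * C1) powr ((1 - q) / q) * real n powr - ((1 - q) / q)"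
      using n C1(1) powr_divide[of "2 * C1" "real n" "(1 - q) / q"] by (simp add: powr_minus_divide)
    finally have t1: "t powr (1 - q) \<le> (2 * C1) powr ((1 - q) / q) * real n powr - ((1 - q) / q)" .
    obtain \<alpha> where \<alpha>: "finite \<alpha>" "\<alpha> \<noteq> {}" "real (card \<alpha>) \<le> 1 + C1 * t powr - q"
      "(LINT x|\<eta>. infdist x \<alpha> powr r) \<le> D powr r * C1 * t powr (1 - q)"
      using main[OF t] by blast
    have "quantization_error \<eta> r n \<le> (LINT x|\<eta>. infdist x \<alpha> powr r) powr (1 / r)"
      using \<alpha> tq by (intro quantization_error_le) (auto simp: Suc_le_eq card_gt_0_iff)
    also have "\<dots> \<le> (C * real n powr - ((1 - q) / q)) powr (1 / r)"
    proof (rule powr_mono2)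
      have "D powr r * C1 * t powr (1 - q)
          \<le> D powr r * C1 * ((2 * C1) powr ((1 - q) / q) * real n powr - ((1 - q) / q))"
        using t1 C1(1) by (intro mult_left_mono) auto
      then show "(LINT x|\<eta>. infdist x \<alpha> powr r) \<le> C * real n powr - ((1 - q) / q)"
        using \<alpha>(4) by (simp add: C_def mult_ac)
      show "0 \<le> (LINT x|\<eta>. infdist x \<alpha> powr r)"
        by (rule Bochner_Integration.integral_nonneg) simp
    qed (use r in simp)
    finally show ?thesis .
  qed
  then show ?thesis
    using C that by blast
qed

text \<open>A set of \<open>k\<close> points comes close to at most \<open>M * k\<close> of the cells of level \<open>m\<close>, so if there are
  many cells of large mass then the remaining ones force a large error.\<close>

lemma integral_infdist_ge_card:
  assumes r: "0 < r"
  obtains M :: nat where "0 < M" and "\<And>\<alpha> F v m. \<lbrakk>finite \<alpha>; \<alpha> \<noteq> {}; F \<subseteq> charged \<eta> m; 0 \<le> v;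
      \<And>z. z \<in> F \<Longrightarrow> v \<le> prob (cell m z)\<rbrakk>
    \<Longrightarrow> (real (card F) - real M * real (card \<alpha>)) * ((2 ^ m) powr - r * v) \<le> (LINT x|\<eta>. infdist x \<alpha> powr r)"
proof -
  let ?d = "real DIM('a)"
  obtain M :: nat where M: "\<And>(z::'a) \<delta> X. \<lbrakk>0 < \<delta>; X \<subseteq> cball z ((?d + 1) * \<delta>);
      \<And>x y. \<lbrakk>x \<in> X; y \<in> X; x \<noteq> y\<rbrakk> \<Longrightarrow> 1 * \<delta> \<le> dist x y\<rbrakk> \<Longrightarrow> finite X \<and> card X \<le> M"
    using packing_bound[of 1] zero_less_one by metis
  have "(real (card F) - real (Suc M) * real (card \<alpha>)) * ((2 ^ m) powr - r * v) \<le> (LINT x|\<eta>. infdist x \<alpha> powr r)"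
    if \<alpha>: "finite \<alpha>" "\<alpha> \<noteq> {}" and F: "F \<subseteq> charged \<eta> m" and v: "0 \<le> v" "\<And>z. z \<in> F \<Longrightarrow> v \<le> prob (cell m z)"
    for \<alpha> F v m
  proof -
    define near where "near = {z \<in> F. \<exists>x\<in>cell m z. infdist x \<alpha> < 1 / 2 ^ m}"
    have finF: "finite F"
      using F finite_charged finite_subset by blast
    have near_sub: "near \<subseteq> F"
      by (auto simp: near_def)
    \<comment> \<open>The corner of a near cell is within \<open>DIM('a) + 1\<close> side lengths of
      a point of \<open>\<alpha>\<close>, and corners are at least one side length apart, so packing
      allows at most \<open>M\<close> near cells per point.\<close>
    have "near \<subseteq> (\<Union>a\<in>\<alpha>. {z \<in> F. dist a z \<le> (?d + 1) * (1 / 2 ^ m)})"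
    proof
      fix z assume "z \<in> near"
      then obtain x where x: "z \<in> F" "x \<in> cell m z" "infdist x \<alpha> < 1 / 2 ^ m"
        by (auto simp: near_def)
      then obtain a where a: "a \<in> \<alpha>" "dist x a < 1 / 2 ^ m"
        using \<alpha> by (auto simp: infdist_notempty cINF_less_iff[OF _ bdd_belowI2[of _ 0]])
      have "z \<in> range (grid_point m)"
        using x(1) F by (auto simp: charged_def)
      then have "grid_point m x = z"
        using x(2) cell_range_eq by blast
      then have "dist x z \<le> ?d / 2 ^ m"
        using dist_grid_point[of x m] by simp
      then have "dist a z \<le> (?d + 1) * (1 / 2 ^ m)"
        using a(2) dist_triangle3[of a z x] by (simp add: add_divide_distrib)
      then show "z \<in> (\<Union>a\<in>\<alpha>. {z \<in> F. dist a z \<le> (?d + 1) * (1 / 2 ^ m)})"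
        using x a by blast
    qed
    then have "card near \<le> card (\<Union>a\<in>\<alpha>. {z \<in> F. dist a z \<le> (?d + 1) * (1 / 2 ^ m)})"
      using \<alpha> finF by (intro card_mono) auto
    also have "\<dots> \<le> (\<Sum>a\<in>\<alpha>. card {z \<in> F. dist a z \<le> (?d + 1) * (1 / 2 ^ m)})"
      by (rule card_UN_le[OF \<alpha>(1)])
    also have "\<dots> \<le> (\<Sum>a\<in>\<alpha>. Suc M)"
    proof (rule sum_mono)
      fix a
      have "card {z \<in> F. dist a z \<le> (?d + 1) * (1 / 2 ^ m)} \<le> M"
        using charged_separated[OF subsetD[OF F] subsetD[OF F]]
        by (intro conjunct2[OF M[of "1 / 2 ^ m" _ a]]) auto
      then show "card {z \<in> F. dist a z \<le> (?d + 1) * (1 / 2 ^ m)} \<le> Suc M"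
        by simp
    qed
    finally have "card near \<le> Suc M * card \<alpha>"
      by (simp add: mult.commute)
    then have "real (card near) \<le> real (Suc M) * real (card \<alpha>)"
      by (metis of_nat_le_iff of_nat_mult)
    moreover have "real (card (F - near)) = real (card F) - real (card near)"
      using finF near_sub by (simp add: card_Diff_subset finite_subset card_mono of_nat_diff)
    ultimately have card_far: "real (card F) - real (Suc M) * real (card \<alpha>) \<le> real (card (F - near))"
      by linarith
    let ?h = "\<lambda>x. \<Sum>z\<in>F - near. (2 ^ m) powr - r * indicator (cell m z) x"
    have int: "integrable \<eta> (\<lambda>x. (2 ^ m) powr - r * indicator (cell m z) x)" for z
      by (intro integrable_mult_right integrable_real_indicator) (auto simp: emeasure_eq_measure)
    \<comment> \<open>The cells are disjoint, so at most one indicator is nonzero, and every point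
      of a far cell has distance at least \<open>1 / 2 ^ m\<close> from
      \<open>\<alpha>\<close>.\<close>
    have ptw: "?h x \<le> infdist x \<alpha> powr r" for x
    proof (cases "grid_point m x \<in> F - near")
      case True
      have "(2 ^ m) powr - r * indicator (cell m z) x = (0::real)" if "z \<in> F - near - {grid_point m x}" for z
      proof -
        have "z \<in> range (grid_point m)"
          using that F by (auto simp: charged_def)
        then have "cell m z = {y. grid_point m y = z}"
          by (rule cell_range_eq)
        then show ?thesis
          using that by (auto simp: indicator_def)
      qed
      then have "?h x = (\<Sum>z\<in>{grid_point m x}. (2 ^ m) powr - r * indicator (cell m z) x)"
        using True finF by (intro sum.mono_neutral_right) auto
      also have "\<dots> = (1 / 2 ^ m) powr r"
        by (simp add: powr_divide powr_minus_divide)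
      also have "\<dots> \<le> infdist x \<alpha> powr r"
        using True r by (intro powr_mono2) (auto simp: near_def not_less)
      finally show ?thesis .
    next
      case False
      have "(2 ^ m) powr - r * indicator (cell m z) x = (0::real)" if "z \<in> F - near" for z
      proof -
        have "z \<in> range (grid_point m)"
          using that F by (auto simp: charged_def)
        then have "cell m z = {y. grid_point m y = z}"
          by (rule cell_range_eq)
        then show ?thesis
          using that False by (auto simp: indicator_def)
      qed
      then have "?h x = 0"
        by (intro sum.neutral) blast
      then show ?thesis
        by simp
    qed
    have "(real (card F) - real (Suc M) * real (card \<alpha>)) * ((2 ^ m) powr - r * v)
        \<le> real (card (F - near)) * ((2 ^ m) powr - r * v)"
      using card_far v by (intro mult_right_mono) auto
    also have "\<dots> = (\<Sum>z\<in>F - near. (2 ^ m) powr - r * v)"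
      by simp
    also have "\<dots> \<le> (\<Sum>z\<in>F - near. (2 ^ m) powr - r * prob (cell m z))"
      using v by (intro sum_mono mult_left_mono) auto
    also have "\<dots> = (\<Sum>z\<in>F - near. LINT x|\<eta>. (2 ^ m) powr - r * indicator (cell m z) x)"
      by simp
    also have "\<dots> = (LINT x|\<eta>. ?h x)"
      by (simp only: Bochner_Integration.integral_sum int)
    also have "\<dots> \<le> (LINT x|\<eta>. infdist x \<alpha> powr r)"
      by (intro integral_mono Bochner_Integration.integrable_sum int integrable_infdist_powr \<alpha> r ptw)
    finally show ?thesis .
  qed
  then show ?thesis
    using that[of "Suc M"] by blast
qed

text \<open>The level \<open>m\<close> is chosen so that the guaranteed number
  \<open>X = (2 ^ m) powr g\<close> of heavy cells is about \<open>2 * M * n\<close>. At least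
  \<open>X / 2\<close> of them stay away from any \<open>n\<close> points, each costing
  \<open>(2 ^ m) powr - (r + a) = X powr (- 1 / q)\<close>, which adds up to the order of
  \<open>n powr - ((1 - q) / q)\<close>.\<close>

lemma quantization_error_lower:
  assumes r: "0 < r" and q: "0 < q" "q < 1" and a: "0 < r + a"
    and many: "\<forall>\<^sub>F m in sequentially.
      (2 ^ m) powr (q * (r + a)) \<le> real (card {z \<in> charged \<eta> m. (2 ^ m) powr - a \<le> prob (cell m z)})"
  obtains C where "0 < C"
    "\<forall>\<^sub>F n in sequentially. (C * real n powr - ((1 - q) / q)) powr (1 / r) \<le> quantization_error \<eta> r n"
proof -
  obtain M :: nat where M: "0 < M" "\<And>\<alpha> F v m. \<lbrakk>finite \<alpha>; \<alpha> \<noteq> {}; F \<subseteq> charged \<eta> m; 0 \<le> v;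
      \<And>z. z \<in> F \<Longrightarrow> v \<le> prob (cell m z)\<rbrakk>
    \<Longrightarrow> (real (card F) - real M * real (card \<alpha>)) * ((2 ^ m) powr - r * v) \<le> (LINT x|\<eta>. infdist x \<alpha> powr r)"
    using integral_infdist_ge_card[OF r] by blast
  obtain m0 where m0: "\<And>m. m0 \<le> m \<Longrightarrow>
      (2 ^ m) powr (q * (r + a)) \<le> real (card {z \<in> charged \<eta> m. (2 ^ m) powr - a \<le> prob (cell m z)})"
    using many by (auto simp: eventually_sequentially)
  define g where "g = q * (r + a)"
  have g: "0 < g"
    using q a by (simp add: g_def)
  define e where "e = (1 - q) / q"
  have e: "0 < e"
    using q by (simp add: e_def)
  define C where "C = (2 * M * 2 powr g) powr - e / 2"
  have C: "0 < C"
    using M(1) by (simp add: C_def)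
  \<comment> \<open>Makes \<open>(2 ^ m0) powr g \<le> n\<close>, so that the level chosen below is
    at least \<open>m0\<close>.\<close>
  define n0 where "n0 = nat \<lceil>(2 ^ m0) powr g\<rceil> + 1"
  have "(C * real n powr - e) powr (1 / r) \<le> quantization_error \<eta> r n" if n: "n0 \<le> n" for n
  proof (rule quantization_error_ge)
    have n1: "1 \<le> n" "(2 ^ m0) powr g \<le> real n"
      using n by (auto simp: n0_def) linarith
    show "1 \<le> n"
      by (rule n1)
    show "0 \<le> C * real n powr - e"
      using C by simp
    \<comment> \<open>Rounding up costs at most a factor \<open>2 powr g\<close>: \<open>X\<close>
      lies between \<open>2 * M * n\<close> and \<open>2 * M * n * 2 powr g\<close>.\<close>
    define m where "m = nat \<lceil>log 2 (2 * M * n) / g\<rceil>"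
    have Mn: "1 \<le> 2 * real M * real n"
      using M(1) n1(1) mult_mono[of 1 "real M" 1 "real n"] by simp
    have lg: "0 \<le> log 2 (2 * M * n) / g"
      using Mn g by simp
    have m_bounds: "log 2 (2 * M * n) / g \<le> m" "m \<le> log 2 (2 * M * n) / g + 1"
      using lg by (auto simp: m_def)
    define X where "X = (2 ^ m) powr g"
    have X: "X = 2 powr (m * g)"
      by (simp add: X_def powr_realpow[symmetric] powr_powr)
    have "log 2 (2 * M * n) \<le> m * g" "m * g \<le> log 2 (2 * M * n) + g"
      using m_bounds g by (auto simp: field_simps)
    then have "2 powr log 2 (2 * M * n) \<le> X" "X \<le> 2 powr (log 2 (2 * M * n) + g)"
      unfolding X by auto
    then have X_bounds: "2 * M * n \<le> X" "X \<le> 2 * M * n * 2 powr g"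
      using Mn by (auto simp: powr_add)
    have "(2 ^ m0) powr g \<le> X"
      using X_bounds(1) n1(2) M(1) mult_mono[of 1 "2 * real M" "real n" "real n"] by simp
    then have "2 powr (m0 * g) \<le> 2 powr (m * g)"
      by (simp add: X powr_realpow[symmetric] powr_powr)
    then have "m0 \<le> m"
      using g by simp
    let ?F = "{z \<in> charged \<eta> m. (2 ^ m) powr - a \<le> prob (cell m z)}"
    have cardF: "X \<le> real (card ?F)"
      using m0[OF \<open>m0 \<le> m\<close>] by (simp add: X_def g_def)
    fix \<alpha> :: "'a set" assume \<alpha>: "finite \<alpha>" "\<alpha> \<noteq> {}" "card \<alpha> \<le> n"
    have "real M * real (card \<alpha>) \<le> real M * real n"
      using \<alpha>(3) by (intro mult_left_mono) auto
    then have half: "X / 2 \<le> real (card ?F) - real M * real (card \<alpha>)"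
      using cardF X_bounds(1) by simp
    have "C * real n powr - e = (2 * M * n * 2 powr g) powr - e / 2"
      using M(1) n1(1) by (simp add: C_def powr_mult)
    also have "\<dots> \<le> X powr - e / 2"
      using X_bounds Mn e by (intro divide_right_mono powr_mono2') (auto simp: X)
    also have "X powr - e = X * X powr (- 1 / q)"
    proof -
      have "- e = 1 + - 1 / q"
        using q by (simp add: e_def field_simps)
      then show ?thesis
        by (simp only: powr_add) (simp add: X)
    qed
    also have "X powr (- 1 / q) = (2 ^ m) powr - r * (2 ^ m) powr - a"
      using q by (simp add: X_def g_def powr_powr powr_add[symmetric])
    also have "X * ((2 ^ m) powr - r * (2 ^ m) powr - a) / 2 = X / 2 * ((2 ^ m) powr - r * (2 ^ m) powr - a)"
      by simp
    also have "\<dots> \<le> (real (card ?F) - real M * real (card \<alpha>)) * ((2 ^ m) powr - r * (2 ^ m) powr - a)"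
      using half by (intro mult_right_mono) auto
    also have "\<dots> \<le> (LINT x|\<eta>. infdist x \<alpha> powr r)"
      using \<alpha> by (intro M(2)) auto
    finally show "C * real n powr - e \<le> (LINT x|\<eta>. infdist x \<alpha> powr r)" .
  qed (rule r)
  then have "\<forall>\<^sub>F n in sequentially. (C * real n powr - e) powr (1 / r) \<le> quantization_error \<eta> r n"
    unfolding eventually_sequentially by blast
  then show ?thesis
    using that C unfolding e_def by blast
qed

end

section \<open>Levels with many cells of large mass\<close>

lemma sum_Un_le_add:
  fixes f :: "'b \<Rightarrow> real"
  assumes "finite A" "finite B" "\<And>x. 0 \<le> f x"
  shows "sum f (A \<union> B) \<le> sum f A + sum f B"
  using sum.union_inter[OF assms(1,2), of f] sum_nonneg[of "A \<inter> B" f] assms(3) by simp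

text \<open>A substitute for differentiability: left and right slopes nearly agree somewhere.
  Otherwise, on a mesh of \<open>2 * k\<close> steps, the nonnegative first differences would grow
  by \<open>\<epsilon> * h\<close> at each step to the left, and the first \<open>k\<close> of them
  would add up to at least \<open>k * k * \<epsilon> * h\<close>.\<close>

lemma small_second_difference:
  fixes b :: "real \<Rightarrow> real"
  assumes "u < v" "0 < \<epsilon>" and b_bounds: "\<And>x. \<lbrakk>u \<le> x; x \<le> v\<rbrakk> \<Longrightarrow> 0 \<le> b x \<and> b x \<le> B"
    and b_antimono: "\<And>x y. \<lbrakk>u \<le> x; x \<le> y; y \<le> v\<rbrakk> \<Longrightarrow> b y \<le> b x"
  obtains q h where "0 < h" "u \<le> q - h" "q + h \<le> v" "(b (q - h) - b q) - (b q - b (q + h)) \<le> \<epsilon> * h"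
proof (rule ccontr)
  assume "\<not> thesis"
  with that have large: "\<epsilon> * h < (b (q - h) - b q) - (b q - b (q + h))"
    if "0 < h" "u \<le> q - h" "q + h \<le> v" for q h
    using that by force
  \<comment> \<open>For \<open>h = (v - u) / (2 * k)\<close> the total
    \<open>k * k * \<epsilon> * h\<close> is \<open>k * \<epsilon> * (v - u) / 2\<close>, which this
    choice makes exceed \<open>B\<close>.\<close>
  obtain k :: nat where k: "2 * B / (\<epsilon> * (v - u)) < real k"
    using reals_Archimedean2 by blast
  have k0: "0 < k"
  proof -
    have "0 \<le> B"
      using b_bounds[OF order_refl less_imp_le[OF assms(1)]] by linarith
    then have "0 \<le> 2 * B / (\<epsilon> * (v - u))"
      using assms(1,2) by (intro divide_nonneg_nonneg) auto
    then show ?thesis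
      using k by simp
  qed
  define h where "h = (v - u) / real (2 * k)"
  have h: "0 < h"
    using assms k0 by (simp add: h_def)
  have hk: "u + real (2 * k) * h = v"
    using k0 by (simp add: h_def)
  have in_range: "u + real i * h \<le> v" if "i \<le> 2 * k" for i
  proof -
    have "real i * h \<le> real (2 * k) * h"
      using that h by (intro mult_right_mono of_nat_mono) auto
    then show ?thesis
      using hk by linarith
  qed
  define \<Delta> where "\<Delta> i = b (u + real i * h) - b (u + real (Suc i) * h)" for i
  have \<Delta>_nonneg: "0 \<le> \<Delta> i" if "i < 2 * k" for i
    using b_antimono[of "u + real i * h" "u + real (Suc i) * h"] in_range[of "Suc i"] that h
    by (simp add: \<Delta>_def distrib_right)
  have \<Delta>_step: "\<Delta> (Suc i) + \<epsilon> * h \<le> \<Delta> i" if "Suc i < 2 * k" for i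
  proof -
    define x where "x = u + real (Suc i) * h"
    have x: "u + real i * h = x - h" "u + real (Suc (Suc i)) * h = x + h"
      by (simp_all add: x_def algebra_simps)
    have "u \<le> u + real i * h"
      using h by simp
    then have "\<epsilon> * h < (b (x - h) - b x) - (b x - b (x + h))"
      using in_range[of "Suc (Suc i)"] that unfolding x by (intro large h) auto
    then show ?thesis
      unfolding \<Delta>_def x x_def[symmetric] by linarith
  qed
  have \<Delta>_lower: "real j * (\<epsilon> * h) \<le> \<Delta> i" if "i + j < 2 * k" for i j
    using that
  proof (induction j arbitrary: i)
    case 0
    then show ?case
      using \<Delta>_nonneg by simp
  next
    case (Suc j)
    have "real (Suc j) * (\<epsilon> * h) = real j * (\<epsilon> * h) + \<epsilon> * h"
      by (simp add: distrib_right)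
    also have "\<dots> \<le> \<Delta> (Suc i) + \<epsilon> * h"
      using Suc by simp
    also have "\<dots> \<le> \<Delta> i"
      using Suc.prems by (intro \<Delta>_step) simp
    finally show ?case .
  qed
  have "real k * (real k * (\<epsilon> * h)) = (\<Sum>i<k. real k * (\<epsilon> * h))"
    by simp
  also have "\<dots> \<le> (\<Sum>i<k. \<Delta> i)"
    by (intro sum_mono \<Delta>_lower) auto
  also have "\<dots> = b u - b (u + real k * h)"
    unfolding \<Delta>_def by (subst sum_lessThan_telescope') simp
  also have "\<dots> \<le> B"
  proof -
    have "0 \<le> b (u + real k * h)"
      using b_bounds[of "u + real k * h"] in_range[of k] h by simp
    moreover have "b u \<le> B"
      using b_bounds[of u] assms(1) by simp
    ultimately show ?thesis
      by linarith
  qed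
  finally have "real k * (real k * (\<epsilon> * h)) \<le> B" .
  moreover have "v - u = 2 * real k * h"
    using k0 by (simp add: h_def)
  ultimately have "real k * (\<epsilon> * (v - u)) \<le> 2 * B"
    by (simp add: mult_ac)
  then show False
    using k assms by (simp add: divide_less_eq)
qed

context bounded_borel_prob
begin

text \<open>The cells whose mass is of order \<open>2\<^sup>-\<^sup>m\<^sup>a\<close>, with \<open>- a\<close> close to a slope of \<open>b\<close> at \<open>q\<close>, carry
  a fixed part of \<open>lq_sum \<eta> q m\<close>; the exponents \<open>q - h\<close> and \<open>q + h\<close> bound the other cells.\<close>

lemma card_cells_lower:
  assumes q: "0 < q" and h: "0 < h" "0 < q - h" "q + h < 1" and \<tau>: "0 < \<tau>" "4 * \<tau> \<le> \<epsilon> * h" "\<tau> < \<epsilon>"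
    and lim: "lq_approx \<eta> (q - h) \<longlonglongrightarrow> b0" "lq_approx \<eta> q \<longlonglongrightarrow> b1" "lq_approx \<eta> (q + h) \<longlonglongrightarrow> b2"
  shows "\<forall>\<^sub>F m in sequentially. (2 ^ m) powr (b1 + ((b1 - b2) / h - \<epsilon>) * q - \<epsilon>)
    \<le> real (card {z \<in> charged \<eta> m. (2 ^ m) powr - ((b0 - b1) / h + \<epsilon>) \<le> prob (cell m z)})"
proof -
  \<comment> \<open>Negated secant slopes of the spectrum to the right and to the left of
    \<open>q\<close>, widened by \<open>\<epsilon>\<close>. The cells of interest have mass between
    \<open>X powr - a2\<close> and \<open>X powr - a1\<close>.\<close>
  define a1 a2 where "a1 = (b1 - b2) / h - \<epsilon>" and "a2 = (b0 - b1) / h + \<epsilon>"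
  have a1h: "a1 * h = b1 - b2 - \<epsilon> * h" and a2h: "a2 * h = b0 - b1 + \<epsilon> * h"
    using h by (simp_all add: a1_def a2_def field_simps)
  have small: "\<forall>\<^sub>F m in sequentially. (2 ^ m) powr - t \<le> (1 / 4 :: real)" if "0 < t" for t
  proof -
    have "((\<lambda>m. (2 powr - t) ^ m) \<longlongrightarrow> 0) sequentially"
      using that powr_less_mono[of "- t" 0 2] by (intro LIMSEQ_realpow_zero) auto
    then have "\<forall>\<^sub>F m in sequentially. (2 powr - t) ^ m < (1 / 4 :: real)"
      by (rule order_tendstoD) simp
    then show ?thesis
      by eventually_elim (simp add: powr_realpow[symmetric] powr_powr mult.commute)
  qed
  have ev0: "\<forall>\<^sub>F m in sequentially. lq_sum \<eta> (q - h) m \<le> (2 ^ m) powr (b0 + \<tau>)"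
    using order_tendstoD(2)[OF lim(1), of "b0 + \<tau>"] h \<tau>
    by (intro eventually_le_powr) (auto simp: lq_approx_eq lq_sum_pos)
  have ev1: "\<forall>\<^sub>F m in sequentially. (2 ^ m) powr (b1 - \<tau>) \<le> lq_sum \<eta> q m"
    using order_tendstoD(1)[OF lim(2), of "b1 - \<tau>"] h \<tau>
    by (intro eventually_ge_powr) (auto simp: lq_approx_eq lq_sum_pos)
  have ev2: "\<forall>\<^sub>F m in sequentially. lq_sum \<eta> (q + h) m \<le> (2 ^ m) powr (b2 + \<tau>)"
    using order_tendstoD(2)[OF lim(3), of "b2 + \<tau>"] h \<tau>
    by (intro eventually_le_powr) (auto simp: lq_approx_eq lq_sum_pos)
  have ev3: "\<forall>\<^sub>F m in sequentially. (2 ^ m) powr - (2 * \<tau>) \<le> (1 / 4 :: real)"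
    using \<tau> by (intro small) simp
  have ev4: "\<forall>\<^sub>F m in sequentially. (2 ^ m) powr - (\<epsilon> - \<tau>) \<le> (1 / 4 :: real)"
    using \<tau> by (intro small) simp
  from ev0 ev1 ev2 ev3 ev4 show ?thesis
  proof eventually_elim
    case (elim m)
    define X :: real where "X = 2 ^ m"
    have X: "1 \<le> X"
      by (simp add: X_def)
    let ?m = "\<lambda>z. prob (cell m z)"
    let ?low = "{z \<in> charged \<eta> m. ?m z < X powr - a2}"
    let ?high = "{z \<in> charged \<eta> m. X powr - a1 < ?m z}"
    let ?F = "{z \<in> charged \<eta> m. X powr - a2 \<le> ?m z}"
    \<comment> \<open>\<open>4 * \<tau> \<le> \<epsilon> * h\<close> leaves a spare factor
      \<open>X powr - (2 * \<tau>)\<close>, which is at most \<open>1 / 4\<close> for large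
      \<open>m\<close>.\<close>
    have quarter: "X powr (b1 + \<tau> - \<epsilon> * h) \<le> X powr (b1 - \<tau>) / 4"
    proof -
      have "X powr (b1 + \<tau> - \<epsilon> * h) \<le> X powr ((b1 - \<tau>) + - (2 * \<tau>))"
        using X \<tau> by (intro powr_mono) auto
      also have "\<dots> = X powr (b1 - \<tau>) * X powr - (2 * \<tau>)"
        by (rule powr_add)
      also have "\<dots> \<le> X powr (b1 - \<tau>) * (1 / 4)"
        using elim(4) by (intro mult_left_mono) (auto simp: X_def)
      finally show ?thesis
        by simp
    qed
    have low: "(\<Sum>z\<in>?low. ?m z powr q) \<le> X powr (b1 - \<tau>) / 4"
    proof -
      \<comment> \<open>On light cells, lowering the exponent to \<open>q - h\<close> gains the
        factor \<open>X powr - (a2 * h)\<close>; on the cells in \<open>?high\<close>, raising it to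
        \<open>q + h\<close> acts likewise.\<close>
      have "(\<Sum>z\<in>?low. ?m z powr q) \<le> (\<Sum>z\<in>?low. X powr - (a2 * h) * ?m z powr (q - h))"
      proof (rule sum_mono)
        fix z assume z: "z \<in> ?low"
        have "?m z powr q = ?m z powr h * ?m z powr (q - h)"
          by (simp add: powr_add[symmetric])
        also have "?m z powr h \<le> (X powr - a2) powr h"
          using z h by (intro powr_mono2) auto
        finally show "?m z powr q \<le> X powr - (a2 * h) * ?m z powr (q - h)"
          by (simp add: powr_powr mult_right_mono)
      qed
      also have "\<dots> \<le> X powr - (a2 * h) * lq_sum \<eta> (q - h) m"
        unfolding lq_sum_def sum_distrib_left by (intro sum_mono2) auto
      also have "\<dots> \<le> X powr - (a2 * h) * X powr (b0 + \<tau>)"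
        using elim(1) by (intro mult_left_mono) (auto simp: X_def)
      also have "\<dots> = X powr (b1 + \<tau> - \<epsilon> * h)"
        by (simp add: powr_add[symmetric] a2h add_diff_eq)
      finally show ?thesis
        using quarter by linarith
    qed
    have high: "(\<Sum>z\<in>?high. ?m z powr q) \<le> X powr (b1 - \<tau>) / 4"
    proof -
      have "(\<Sum>z\<in>?high. ?m z powr q) \<le> (\<Sum>z\<in>?high. X powr (a1 * h) * ?m z powr (q + h))"
      proof (rule sum_mono)
        fix z assume z: "z \<in> ?high"
        have "?m z powr q = ?m z powr - h * ?m z powr (q + h)"
          by (simp add: powr_add[symmetric])
        also have "?m z powr - h \<le> (X powr - a1) powr - h"
          using z h X by (intro powr_mono2') auto
        finally show "?m z powr q \<le> X powr (a1 * h) * ?m z powr (q + h)"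
          by (simp add: powr_powr mult_right_mono)
      qed
      also have "\<dots> \<le> X powr (a1 * h) * lq_sum \<eta> (q + h) m"
        unfolding lq_sum_def sum_distrib_left by (intro sum_mono2) auto
      also have "\<dots> \<le> X powr (a1 * h) * X powr (b2 + \<tau>)"
        using elim(3) by (intro mult_left_mono) (auto simp: X_def)
      also have "\<dots> = X powr (b1 + \<tau> - \<epsilon> * h)"
        by (simp add: powr_add[symmetric] a1h add_diff_eq)
      finally show ?thesis
        using quarter by linarith
    qed
    have "X powr (b1 - \<tau>) \<le> lq_sum \<eta> q m"
      using elim(2) by (simp add: X_def)
    also have "\<dots> \<le> (\<Sum>z\<in>?low \<union> ?high \<union> (?F - ?high). ?m z powr q)"
      unfolding lq_sum_def by (intro sum_mono2) (auto simp: not_less)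
    also have "\<dots> \<le> (\<Sum>z\<in>?low. ?m z powr q) + (\<Sum>z\<in>?high. ?m z powr q) + (\<Sum>z\<in>?F - ?high. ?m z powr q)"
      by (intro order_trans[OF sum_Un_le_add] add_right_mono sum_Un_le_add) auto
    also have "\<dots> \<le> X powr (b1 - \<tau>) / 2 + (\<Sum>z\<in>?F - ?high. ?m z powr q)"
      using low high by simp
    also have "(\<Sum>z\<in>?F - ?high. ?m z powr q) \<le> (\<Sum>z\<in>?F - ?high. X powr - (a1 * q))"
    proof (rule sum_mono)
      fix z assume "z \<in> ?F - ?high"
      then have "?m z powr q \<le> (X powr - a1) powr q"
        using q by (intro powr_mono2) auto
      then show "?m z powr q \<le> X powr - (a1 * q)"
        by (simp add: powr_powr)
    qed
    also have "\<dots> \<le> (\<Sum>z\<in>?F. X powr - (a1 * q))"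
      by (intro sum_mono2) auto
    finally have half: "X powr (b1 - \<tau>) / 2 \<le> real (card ?F) * X powr - (a1 * q)"
      by simp
    \<comment> \<open>The loss of \<open>\<epsilon>\<close> in the exponent absorbs
      \<open>\<tau>\<close> and the constant factor.\<close>
    have "X powr (b1 + a1 * q - \<epsilon>) = X powr (a1 * q) * (X powr (b1 - \<tau>) * X powr - (\<epsilon> - \<tau>))"
      by (simp add: powr_add[symmetric] algebra_simps)
    also have "\<dots> \<le> X powr (a1 * q) * (X powr (b1 - \<tau>) * (1 / 4))"
      using elim(5) by (intro mult_left_mono) (auto simp: X_def)
    also have "\<dots> \<le> X powr (a1 * q) * (real (card ?F) * X powr - (a1 * q))"
    proof (rule mult_left_mono)
      show "X powr (b1 - \<tau>) * (1 / 4) \<le> real (card ?F) * X powr - (a1 * q)"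
        using half powr_ge_zero[of X "b1 - \<tau>"] by linarith
    qed simp
    also have "\<dots> = real (card ?F)"
      using X by (simp add: powr_add[symmetric] mult.left_commute)
    finally show ?case
      by (simp add: X_def a1_def a2_def)
  qed
qed

text \<open>Where left and right slopes nearly agree, \<open>card_cells_lower\<close> gives the
  exponent \<open>b q + a1 * q - \<epsilon>\<close> with \<open>a - a1 \<le> 3 * \<epsilon>\<close>.
  As \<open>r * q \<le> b q\<close>, this is at least \<open>q * (r + a1) - \<epsilon>\<close>, and
  the gap between \<open>q'\<close> and \<open>q\<close> pays for the errors.\<close>

lemma exists_many_large_cells:
  assumes r: "0 < r" and q': "0 < q'" "q' < u" "u < v" "v < 1"
    and lim: "\<And>x. \<lbrakk>u \<le> x; x \<le> v\<rbrakk> \<Longrightarrow> lq_approx \<eta> x \<longlonglongrightarrow> b x"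
    and above: "\<And>x. \<lbrakk>u \<le> x; x \<le> v\<rbrakk> \<Longrightarrow> r * x \<le> b x"
  obtains a where "0 < r + a" "\<forall>\<^sub>F m in sequentially. (2 ^ m) powr (q' * (r + a))
    \<le> real (card {z \<in> charged \<eta> m. (2 ^ m) powr - a \<le> prob (cell m z)})"
proof -
  have antimono: "b y \<le> b x" if "u \<le> x" "x \<le> y" "y \<le> v" for x y
  proof (rule LIMSEQ_le[OF lim lim])
    have "lq_approx \<eta> y n \<le> lq_approx \<eta> x n" for n
      unfolding lq_approx_eq using that q' lq_sum_antimono[of x y n]
      by (intro divide_right_mono) (auto simp: lq_sum_pos)
    then show "\<exists>k. \<forall>n\<ge>k. lq_approx \<eta> y n \<le> lq_approx \<eta> x n"
      by blast
  qed (use that in auto)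
  define d where "d = u - q'"
  have d: "0 < d" "d < 1"
    using q' by (auto simp: d_def)
  \<comment> \<open>Chosen such that \<open>d * (r - \<epsilon>) = 4 * \<epsilon>\<close>: the gap
    \<open>d\<close> times the lower bound \<open>r - \<epsilon>\<close> for \<open>r + a1\<close>
    covers the losses \<open>3 * \<epsilon>\<close> and \<open>\<epsilon>\<close>.\<close>
  define \<epsilon> where "\<epsilon> = r * d / (d + 4)"
  have \<epsilon>: "0 < \<epsilon>" "\<epsilon> * (d + 4) = r * d" "\<epsilon> < r"
    using r d by (auto simp: \<epsilon>_def divide_less_eq)
  have "0 \<le> b x \<and> b x \<le> b u" if "u \<le> x" "x \<le> v" for x
    using antimono[of u x] that above[of x] r q' by (auto intro: order_trans[of 0 "r * x"])
  then obtain q h where qh: "0 < h" "u \<le> q - h" "q + h \<le> v"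
    "(b (q - h) - b q) - (b q - b (q + h)) \<le> \<epsilon> * h"
    using antimono by (rule small_second_difference[OF q'(3) \<epsilon>(1)])
  define a1 where "a1 = (b q - b (q + h)) / h - \<epsilon>"
  define a where "a = (b (q - h) - b q) / h + \<epsilon>"
  have a_nonneg: "0 \<le> a"
    using antimono[of "q - h" q] qh \<epsilon> by (simp add: a_def)
  have a1_ge: "- \<epsilon> \<le> a1"
    using antimono[of q "q + h"] qh by (simp add: a1_def)
  have "a - a1 \<le> 3 * \<epsilon>"
  proof -
    have "(b (q - h) - b q) / h - (b q - b (q + h)) / h \<le> \<epsilon>"
      using qh by (simp add: diff_divide_distrib[symmetric] divide_le_eq)
    then show ?thesis
      by (simp add: a_def a1_def)
  qed
  have q_range: "u \<le> q" "q \<le> v" "q < 1"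
    using qh q' by auto
  have exponent: "q' * (r + a) \<le> b q + a1 * q - \<epsilon>"
  proof -
    have "q' * (r + a) \<le> q' * (r + a1 + 3 * \<epsilon>)"
      using \<open>a - a1 \<le> 3 * \<epsilon>\<close> q' by (intro mult_left_mono) auto
    also have "\<dots> = q' * (r + a1) + q' * (3 * \<epsilon>)"
      by (simp add: distrib_left)
    also have "\<dots> \<le> q' * (r + a1) + 1 * (3 * \<epsilon>)"
      using q' \<epsilon> by (intro add_left_mono mult_right_mono) auto
    also have "\<dots> = q' * (r + a1) + (d * (r - \<epsilon>) - \<epsilon>)"
      using \<epsilon>(2) by (simp add: algebra_simps)
    also have "\<dots> \<le> q' * (r + a1) + ((q - q') * (r + a1) - \<epsilon>)"
      using a1_ge \<epsilon> d q_range by (intro add_left_mono diff_right_mono mult_mono) (auto simp: d_def)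
    also have "\<dots> = r * q + a1 * q - \<epsilon>"
      by (simp add: algebra_simps)
    also have "\<dots> \<le> b q + a1 * q - \<epsilon>"
      using above[of q] q_range by simp
    finally show ?thesis .
  qed
  have "h < 1"
    using qh q' by simp
  have "\<forall>\<^sub>F m in sequentially. (2 ^ m) powr (b q + a1 * q - \<epsilon>)
    \<le> real (card {z \<in> charged \<eta> m. (2 ^ m) powr - a \<le> prob (cell m z)})"
    unfolding a1_def a_def
  proof (rule card_cells_lower[where \<tau> = "\<epsilon> * h / 4"])
    show "\<epsilon> * h / 4 < \<epsilon>"
      using \<epsilon> qh(1) \<open>h < 1\<close> mult_strict_left_mono[of h 1 \<epsilon>] by linarith
  qed (use qh q' \<epsilon> lim in auto)
  then have "\<forall>\<^sub>F m in sequentially. (2 ^ m) powr (q' * (r + a))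
    \<le> real (card {z \<in> charged \<eta> m. (2 ^ m) powr - a \<le> prob (cell m z)})"
  proof eventually_elim
    case (elim m)
    have "(2 ^ m) powr (q' * (r + a)) \<le> (2 ^ m) powr (b q + a1 * q - \<epsilon>)"
      using exponent by (intro powr_mono) auto
    with elim show ?case
      by linarith
  qed
  then show ?thesis
    using that[of a] a_nonneg r by auto
qed

end

subsection \<open>Quantization dimension\<close>

lemma ln_ratio_tendsto:
  fixes e r C :: real
  assumes "e \<noteq> 0"
  shows "(\<lambda>n. r * ln (real n) / (e * ln (real n) - C)) \<longlonglongrightarrow> r / e"
proof -
  have ln_top: "filterlim (\<lambda>n. ln (real n)) at_top sequentially"
    by (rule filterlim_compose[OF ln_at_top filterlim_real_sequentially])
  have "(\<lambda>n. C / ln (real n)) \<longlonglongrightarrow> 0"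
    by (rule tendsto_divide_0[OF tendsto_const filterlim_at_top_imp_at_infinity[OF ln_top]])
  then have "(\<lambda>n. r / (e - C / ln (real n))) \<longlonglongrightarrow> r / (e - 0)"
    using assms by (intro tendsto_intros) auto
  moreover have "\<forall>\<^sub>F n in sequentially. r / (e - C / ln (real n)) = r * ln (real n) / (e * ln (real n) - C)"
    using eventually_gt_at_top[of 1]
  proof eventually_elim
    case (elim n)
    then have "ln (real n) \<noteq> 0"
      by simp
    then show ?case
      using mult_divide_mult_cancel_right[of "ln (real n)" r "e - C / ln (real n)"] by (simp add: left_diff_distrib)
  qed
  ultimately show ?thesis
    by (simp add: Lim_transform_eventually)
qed

lemma ln_power_bound:
  fixes C e r :: real
  assumes "0 < C" "0 < n" "r \<noteq> 0"
  shows "ln ((C * real n powr - e) powr (1 / r)) = - ((e * ln (real n) - ln C) / r)"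
proof -
  have "ln ((C * real n powr - e) powr (1 / r)) = 1 / r * ln (C * real n powr - e)"
    by (rule ln_powr)
  also have "ln (C * real n powr - e) = ln C - e * ln (real n)"
    using assms by (simp add: ln_mult ln_powr)
  finally show ?thesis
    by (simp add: diff_divide_distrib)
qed

lemma eventually_scale_pos:
  fixes e C :: real
  assumes "0 < e"
  shows "\<forall>\<^sub>F n in sequentially. 0 < e * ln (real n) - C"
proof -
  have ln_top: "filterlim (\<lambda>n. ln (real n)) at_top sequentially"
    by (rule filterlim_compose[OF ln_at_top filterlim_real_sequentially])
  then have "\<forall>\<^sub>F n in sequentially. C / e < ln (real n)"
    by (simp add: filterlim_at_top_dense)
  then show ?thesis
    by eventually_elim (use assms in \<open>simp add: divide_less_eq mult.commute\<close>)
qed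

context bounded_borel_prob
begin

lemma quantization_error_nonneg:
  "1 \<le> n \<Longrightarrow> 0 < r \<Longrightarrow> 0 \<le> quantization_error \<eta> r n"
  using quantization_error_ge[of n 0 r] by (simp add: Bochner_Integration.integral_nonneg)

text \<open>The exponent \<open>e = (1 - q) / q\<close> of the error bound gives the limit
  \<open>r / e = r * q / (1 - q)\<close>. The first conjunct records the sign of the logarithm, on
  which the comparison of reciprocals in the lower estimate relies.\<close>

lemma eventually_quantization_ratio_upper:
  assumes r: "0 < r" and q: "0 < q" "q < 1" and lim: "lq_approx \<eta> q \<longlonglongrightarrow> \<beta>" "\<beta> < r * q"
    and a: "r * q / (1 - q) < a"
  shows "\<forall>\<^sub>F n in sequentially. (quantization_error \<eta> r n = 0 \<or> 0 < - ln (quantization_error \<eta> r n)) \<and>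
    ln (real n) / (- ln (quantization_error \<eta> r n)) < a"
proof -
  obtain s where s: "\<beta> < s" "s < r * q"
    using lim(2) dense by blast
  obtain K where K: "\<And>n. lq_sum \<eta> q n \<le> K * (2 ^ n) powr s"
    using lq_sum_upper[OF lim(1) _ s(1)] q by auto
  define e where "e = (1 - q) / q"
  have e: "0 < e" "r * q / (1 - q) = r / e"
    using q by (auto simp: e_def)
  obtain C where C: "0 < C" "\<And>n. 2 \<le> n \<Longrightarrow> quantization_error \<eta> r n \<le> (C * real n powr - e) powr (1 / r)"
    using quantization_error_upper[OF r q K s(2)] unfolding e_def by blast
  have "0 < a"
    using a r q by (intro less_trans[OF _ a]) auto
  have "\<forall>\<^sub>F n in sequentially. r * ln (real n) / (e * ln (real n) - ln C) < a"
    using order_tendstoD(2)[OF ln_ratio_tendsto[of e r "ln C"]] e a by auto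
  then show ?thesis
    using eventually_scale_pos[OF e(1), of "ln C"] eventually_ge_at_top[of 2]
  proof eventually_elim
    case (elim n)
    let ?E = "quantization_error \<eta> r n"
    show ?case
    \<comment> \<open>For error 0 the quotient is \<open>x / 0 = 0\<close>, which is below the
      positive \<open>a\<close>.\<close>
    proof (cases "?E = 0")
      case False
      then have E: "0 < ?E"
        using quantization_error_nonneg[of n r] r elim(3) by simp
      then have "ln ?E \<le> ln ((C * real n powr - e) powr (1 / r))"
        using C(2)[OF elim(3)] by (intro ln_mono) auto
      also have "\<dots> = - ((e * ln (real n) - ln C) / r)"
        using C(1) r elim(3) by (intro ln_power_bound) auto
      finally have le: "(e * ln (real n) - ln C) / r \<le> - ln ?E"
        by simp
      have pos: "0 < (e * ln (real n) - ln C) / r"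
        using elim(2) r by simp
      have "ln (real n) / (- ln ?E) \<le> ln (real n) / ((e * ln (real n) - ln C) / r)"
        using le pos elim(3) by (intro divide_left_mono mult_pos_pos) auto
      also have "\<dots> < a"
        using elim(1) by (simp add: mult.commute)
      finally show ?thesis
        using le pos by simp
    qed (use \<open>0 < a\<close> in simp)
  qed
qed

lemma eventually_quantization_ratio_lower:
  assumes r: "0 < r" and q: "0 < q" "q < u" "u < v" "v < 1"
    and lim: "\<And>x. \<lbrakk>u \<le> x; x \<le> v\<rbrakk> \<Longrightarrow> lq_approx \<eta> x \<longlonglongrightarrow> b x"
    and above: "\<And>x. \<lbrakk>u \<le> x; x \<le> v\<rbrakk> \<Longrightarrow> r * x \<le> b x"
    and a: "a < r * q / (1 - q)"
    and nonneg: "\<forall>\<^sub>F n in sequentially. quantization_error \<eta> r n = 0 \<or> 0 < - ln (quantization_error \<eta> r n)"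
  shows "\<forall>\<^sub>F n in sequentially. a < ln (real n) / (- ln (quantization_error \<eta> r n))"
proof -
  obtain \<gamma> where \<gamma>: "0 < r + \<gamma>" "\<forall>\<^sub>F m in sequentially. (2 ^ m) powr (q * (r + \<gamma>))
      \<le> real (card {z \<in> charged \<eta> m. (2 ^ m) powr - \<gamma> \<le> prob (cell m z)})"
    using exists_many_large_cells[OF r q lim above] by blast
  define e where "e = (1 - q) / q"
  have q1: "q < 1"
    using q by simp
  have e: "0 < e" "r * q / (1 - q) = r / e"
    using q by (auto simp: e_def)
  obtain C where C: "0 < C"
    "\<forall>\<^sub>F n in sequentially. (C * real n powr - e) powr (1 / r) \<le> quantization_error \<eta> r n"
    using quantization_error_lower[OF r q(1) q1 \<gamma>] unfolding e_def by blast
  have "\<forall>\<^sub>F n in sequentially. a < r * ln (real n) / (e * ln (real n) - ln C)"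
    using order_tendstoD(1)[OF ln_ratio_tendsto[of e r "ln C"]] e a by auto
  then show ?thesis
    using eventually_scale_pos[OF e(1), of "ln C"] eventually_ge_at_top[of 2] C(2) nonneg
  proof eventually_elim
    case (elim n)
    let ?E = "quantization_error \<eta> r n"
    have pos: "0 < (C * real n powr - e) powr (1 / r)"
      using C(1) elim(3) by simp
    have "- ((e * ln (real n) - ln C) / r) = ln ((C * real n powr - e) powr (1 / r))"
      using C(1) r elim(3) by (intro ln_power_bound[symmetric]) auto
    also have "\<dots> \<le> ln ?E"
      using pos elim(4) by (intro ln_mono) auto
    finally have le: "- ln ?E \<le> (e * ln (real n) - ln C) / r"
      by simp
    \<comment> \<open>The lower bound makes the error positive, so \<open>nonneg\<close> leaves only
      the case of a positive \<open>- ln ?E\<close>.\<close>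
    have E: "0 < - ln ?E"
      using elim(5) less_le_trans[OF pos elim(4)] by (metis less_irrefl)
    have "a < ln (real n) / ((e * ln (real n) - ln C) / r)"
      using elim(1) by (simp add: mult.commute)
    also have "\<dots> \<le> ln (real n) / (- ln ?E)"
      using le E elim(2,3) r by (intro divide_left_mono mult_pos_pos) auto
    finally show ?case .
  qed
qed

text \<open>The critical exponent separates \<open>b q < r * q\<close> from
  \<open>r * q \<le> b q\<close>. Exponents just above it give upper estimates and exponents just
  below it lower ones, and both meet because \<open>r * q / (1 - q)\<close> is continuous and
  increasing in \<open>q\<close>.\<close>

theorem quantization_dimension_of_limit_spectrum:
  assumes r: "0 < r" and lim: "\<And>q. \<lbrakk>0 < q; q < 1\<rbrakk> \<Longrightarrow> lq_approx \<eta> q \<longlonglongrightarrow> b q"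
  shows "has_quantization_dimension \<eta> r (r * q_crit \<eta> r / (1 - q_crit \<eta> r))"
proof -
  define Q where "Q = q_crit \<eta> r"
  define S where "S = {q. 0 < q \<and> lq_spectrum \<eta> q < ereal (r * q)}"
  have Q: "Q = Inf S"
    by (simp add: Q_def S_def q_crit_def)
  have S_iff: "q \<in> S \<longleftrightarrow> b q < r * q" if "0 < q" "q < 1" for q
    using that lq_spectrum_eqI[OF lim[OF that]] by (simp add: S_def)
  have bdd: "bdd_below S"
    by (rule bdd_belowI[of _ 0]) (auto simp: S_def)
  define D where "D = real DIM('a)"
  have D: "0 < D"
    by (simp add: D_def)
  \<comment> \<open>The midpoint between 1 and the solution \<open>D / (D + r)\<close> of
    \<open>D * (1 - q) = r * q\<close>.\<close>
  define q1 where "q1 = (2 * D + r) / (2 * (D + r))"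
  have q1: "0 < q1" "q1 < 1" "D * (1 - q1) < r * q1"
    using r D by (auto simp: q1_def field_simps intro!: add_pos_pos mult_pos_pos)
  have "q1 \<in> S"
    using lq_approx_limit_bounds(2)[OF lim[OF q1(1,2)]] q1 by (simp add: S_iff D_def)
  then have "Q \<le> q1"
    unfolding Q by (rule cInf_lower) (rule bdd)
  then have Q1: "Q < 1"
    using q1 by simp
  have Q0: "0 \<le> Q"
    unfolding Q using \<open>q1 \<in> S\<close> by (intro cInf_greatest) (auto simp: S_def)
  have below: "b q < r * q" if "Q < q" "q < 1" for q
  proof -
    \<comment> \<open>The strict inequality at some \<open>p < q\<close> persists up to
      \<open>q\<close>, because \<open>b\<close> is nonincreasing and \<open>r * q\<close>
      increases.\<close>
    obtain p where p: "p \<in> S" "p < q"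
      using cInf_lessD[of S q] \<open>q1 \<in> S\<close> \<open>Q < q\<close> Q by auto
    have p01: "0 < p" "p < 1"
      using p that by (auto simp: S_def)
    have "lq_approx \<eta> q n \<le> lq_approx \<eta> p n" for n
      unfolding lq_approx_eq using p p01 that lq_sum_antimono[of p q n]
      by (intro divide_right_mono) (auto simp: lq_sum_pos)
    then have "b q \<le> b p"
      using p p01 that by (intro LIMSEQ_le[OF lim lim]) auto
    also have "\<dots> < r * p"
      using p p01 S_iff by simp
    also have "\<dots> < r * q"
      using p r by simp
    finally show ?thesis .
  qed
  have above: "r * q \<le> b q" if "0 < q" "q < Q" for q
  proof -
    have "q \<notin> S"
      using that cInf_lower[OF _ bdd, of q] Q by auto
    then show ?thesis
      using S_iff that Q1 by (simp add: not_less)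
  qed
  have ratio_less: "r * q / (1 - q) < a \<longleftrightarrow> q < a / (r + a)"
    and ratio_greater: "a < r * q / (1 - q) \<longleftrightarrow> a / (r + a) < q" if "q < 1" "0 \<le> a" for q a
    using that r by (auto simp: field_simps)
  have upper: "\<forall>\<^sub>F n in sequentially. (quantization_error \<eta> r n = 0 \<or> 0 < - ln (quantization_error \<eta> r n)) \<and>
      ln (real n) / (- ln (quantization_error \<eta> r n)) < a" if a: "r * Q / (1 - Q) < a" for a
  proof -
    have "0 \<le> r * Q / (1 - Q)"
      using r Q0 Q1 by simp
    then have a0: "0 < a"
      using a by linarith
    then have "Q < min 1 (a / (r + a))"
      using a Q1 ratio_less[of Q a] by simp
    then obtain q where q: "Q < q" "q < min 1 (a / (r + a))"
      using dense by blast
    then have "r * q / (1 - q) < a"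
      using ratio_less[of q a] a0 by simp
    then show ?thesis
      using q Q0 r by (intro eventually_quantization_ratio_upper[OF r _ _ lim below]) auto
  qed
  have "(\<lambda>n. ln (real n) / (- ln (quantization_error \<eta> r n))) \<longlonglongrightarrow> r * Q / (1 - Q)"
  proof (rule order_tendstoI)
    fix a assume a: "a < r * Q / (1 - Q)"
    show "\<forall>\<^sub>F n in sequentially. a < ln (real n) / (- ln (quantization_error \<eta> r n))"
    \<comment> \<open>For negative \<open>a\<close> it suffices that the quotient is eventually
      nonnegative; this covers \<open>Q = 0\<close>, where no positive exponent below
      \<open>Q\<close> exists. For \<open>0 \<le> a\<close> the assumption makes \<open>Q\<close>
      positive.\<close>
    proof (cases "a < 0")
      case True
      show ?thesis
        using upper[of "r * Q / (1 - Q) + 1", simplified] eventually_ge_at_top[of 1]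
      proof eventually_elim
        case (elim n)
        then have "0 \<le> - ln (quantization_error \<eta> r n)"
          by auto
        then have "0 \<le> ln (real n) / (- ln (quantization_error \<eta> r n))"
          using elim(2) by (intro divide_nonneg_nonneg) auto
        then show ?case
          using True by linarith
      qed
    next
      case False
      then have "a / (r + a) < Q"
        using a Q1 ratio_greater[of Q a] by simp
      then obtain q where q: "a / (r + a) < q" "q < Q"
        using dense by blast
      have q0: "0 < q"
        using q(1) False r by (intro le_less_trans[OF _ q(1)]) auto
      obtain u where u: "q < u" "u < Q"
        using q(2) dense by blast
      obtain v where v: "u < v" "v < Q"
        using u(2) dense by blast
      have aq: "a < r * q / (1 - q)"
        using q Q1 False ratio_greater[of q a] by simp
      show ?thesis
      proof (rule eventually_quantization_ratio_lower[OF r q0 u(1) v(1) _ _ _ aq])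
        show "v < 1"
          using v Q1 by simp
        show "lq_approx \<eta> x \<longlonglongrightarrow> b x" "r * x \<le> b x" if "u \<le> x" "x \<le> v" for x
          using that q0 u v Q1 by (auto intro!: lim above)
        show "\<forall>\<^sub>F n in sequentially. quantization_error \<eta> r n = 0 \<or> 0 < - ln (quantization_error \<eta> r n)"
          using upper[of "r * Q / (1 - Q) + 1"] by (auto elim: eventually_mono)
      qed
    qed
  next
    fix a assume "r * Q / (1 - Q) < a"
    then show "\<forall>\<^sub>F n in sequentially. ln (real n) / (- ln (quantization_error \<eta> r n)) < a"
      by (rule eventually_mono[OF upper]) simp
  qed
  then show ?thesis
    by (simp add: has_quantization_dimension_def Q_def)
qed

end

section \<open>Inhomogeneous self-similar measures under the open set condition\<close>

theorem corollary1p14: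
  fixes N :: nat
    and f :: "nat \<Rightarrow> 'a::euclidean_space \<Rightarrow> 'a"
    and c p :: "nat \<Rightarrow> real"
    and \<mu> \<nu> :: "'a measure"
  assumes "\<forall>i\<in>{1..N}. contractive_similitude (c i) (f i)"
    and "\<forall>i\<in>{0..N}. 0 < p i \<and> p i < 1"
    and "(\<Sum>i=0..N. p i) = 1"
    and "compactly_supported_borel_prob \<mu>"
    and "inhom_self_similar_measure N f p \<mu> \<nu>"
    and "iOSC N f \<mu>"
    and "lq_spectrum_exists_as_limit \<mu>"
  shows "(\<forall>r>0. has_quantization_dimension \<nu> r (r * q_crit \<nu> r / (1 - q_crit \<nu> r))) \<and>
         (\<forall>q\<in>{0<..<1}. lq_spectrum \<nu> q = max (lq_spectrum \<mu> q) (ereal (rho N p c q)))"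
proof -
  obtain R\<^sub>\<mu> R\<^sub>\<nu> where "bounded_borel_prob \<mu> R\<^sub>\<mu>" "bounded_borel_prob \<nu> R\<^sub>\<nu>"
    using compactly_supported_imp_bounded_borel_prob assms(4,5)
    unfolding inhom_self_similar_measure_def by metis
  then interpret inhom_ifs \<mu> \<nu> R\<^sub>\<mu> R\<^sub>\<nu> N f c p
    using assms(1,2,3,5)
    by (auto simp: inhom_ifs_def inhom_ifs_axioms_def inhom_self_similar_measure_def)
  obtain U where U: "open U" "U \<noteq> {}" "\<And>i. i \<in> {1..N} \<Longrightarrow> f i ` U \<subseteq> U"
      "\<And>i j. \<lbrakk>i \<in> {1..N}; j \<in> {1..N}; i \<noteq> j\<rbrakk> \<Longrightarrow> f i ` U \<inter> f j ` U = {}"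
    using assms(6) unfolding iOSC_def by metis
  have "\<exists>\<beta>. lq_spectrum \<mu> q = ereal \<beta> \<and> lq_approx \<mu> q \<longlonglongrightarrow> \<beta>" if "0 < q" "q < 1" for q
    using assms(7) that mu.lq_spectrum_limit[of q] by (auto simp: lq_spectrum_exists_as_limit_def)
  then obtain \<beta> where \<beta>: "\<And>q. \<lbrakk>0 < q; q < 1\<rbrakk> \<Longrightarrow> lq_spectrum \<mu> q = ereal (\<beta> q)"
    "\<And>q. \<lbrakk>0 < q; q < 1\<rbrakk> \<Longrightarrow> lq_approx \<mu> q \<longlonglongrightarrow> \<beta> q"
    by metis
  have lim: "lq_approx \<nu> q \<longlonglongrightarrow> max (\<beta> q) (rho N p c q)" if "0 < q" "q < 1" for q
    using lq_approx_nu_tendsto[OF that \<beta>(2)[OF that] U] .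
  show ?thesis
  proof (intro conjI allI impI ballI)
    fix r :: real assume "0 < r"
    then show "has_quantization_dimension \<nu> r (r * q_crit \<nu> r / (1 - q_crit \<nu> r))"
      by (rule nu.quantization_dimension_of_limit_spectrum[OF _ lim])
  next
    fix q :: real assume "q \<in> {0<..<1}"
    then show "lq_spectrum \<nu> q = max (lq_spectrum \<mu> q) (ereal (rho N p c q))"
      using nu.lq_spectrum_eqI[OF lim] \<beta>(1) by (simp add: ereal_max)
  qed
qed

end
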